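(* Let $V=V_1\oplus V_2$ be a finite-dimensional vector space over a field $F$, let $v_1,\dots,v_{d_1}$ be a basis of $V_1$ and $v_{d_1+1},\dots,v_{d_1+d_2}$ a basis of $V_2$, and put $d=d_1+d_2$. Then the following equalities hold in $\mathrm{St}(V)\otimes_{\mathbb Q}\mathrm{St}(V)$: $$\mathrm L[v_1,\dots,v_{d_1}]\cdot\mathrm L[v_{d_1+1},\dots,v_{d_1+d_2}]=\sum_{\sigma\in\Sigma_{d_1,d_2}}\mathrm L[v_{\sigma(1)},\dots,v_{\sigma(d)}],$$ $$\mathrm I[v_1,\dots,v_{d_1}]\cdot\mathrm I[v_{d_1+1},\dots,v_{d_1+d_2}]=\sum_{\sigma\in\Sigma_{d_1,d_2}}\mathrm I[v_{\sigma(1)},\dots,v_{\sigma(d)}],$$ where $\Sigma_{d_1,d_2}\subseteq\mathfrak S_d$ is the set of $(d_1,d_2)$-shuffles.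
   Context: **Steinberg module.** For a $d$-dimensional vector space $V$ over $F$, $\mathrm{St}(V)=\widetilde H_{d-2}(\mathcal T_V,\mathbb Q)$ ($\mathcal T_V$ the Tits building), with $\mathrm{St}(V)=\mathbb Q$ if $d\le 1$. Equivalently it is the $\mathbb Q$-vector space generated by apartments $[v_1,\dots,v_d]$, $v_i\in V\setminus\{0\}$, which vanish for linearly dependent $v_i$, are skew-symmetric, are unchanged when a $v_i$ is multiplied by an element of $F^\times$, and satisfy $\sum_{i=0}^d(-1)^i[v_0,\dots,\widehat{v_i},\dots,v_d]=0$ for nonzero $v_0,\dots,v_d\in V$. Put $\mathrm{St}^2(V)=\mathrm{St}(V)\otimes_{\mathbb Q}\mathrm{St}(V)$. **Product.** For $V=V_1\oplus V_2$ let $m:\mathrm{St}(V_1)\otimes\mathrm{St}(V_2)\to\mathrm{St}(V)$, $[v_1,\dots,v_{d_1}]\otimes[v_{d_1+1},\dots,v_{d_1+d_2}]\mapsto[v_1,\dots,v_{d_1+d_2}]$. The product $\mathrm{St}^2(V_1)\otimes\mathrm{St}^2(V_2)\to\mathrm{St}^2(V)$ is $(a_1\otimes b_1)\cdot(a_2\otimes b_2)=m(a_1,a_2)\otimes m(b_1,b_2)$. **Steinberg polylogarithms and iterated integrals.** For a basis $v_1,\dots,v_d$ of $V$, $$\mathrm L[v_1,\dots,v_d]=[v_d,v_d+v_{d-1},\dots,v_d+\dots+v_1]\otimes[v_d,v_{d-1},\dots,v_1],$$ $$\mathrm I[v_1,\dots,v_d]=(-1)^d[v_d,v_{d-1},\dots,v_1]\otimes[v_d,v_{d-1}-v_d,\dots,v_1-v_2].$$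 $\Sigma_{d_1,d_2}$ consists of $\sigma\in\mathfrak S_{d_1+d_2}$ with $\sigma^{-1}(1)<\dots<\sigma^{-1}(d_1)$ and $\sigma^{-1}(d_1+1)<\dots<\sigma^{-1}(d_1+d_2)$. *)

theory Defs
  imports
    Complex_Main
    "HOL-Library.Poly_Mapping"
    "HOL-Combinatorics.Permutations"
    "HOL-Algebra.Module"
begin

section \<open>Rational vector spaces given by generators and relations\<close>

text \<open>
  The free \<open>\<rat>\<close>-vector space on a set \<open>S\<close> of generators consists of the finitely supported functions
  \<open>'g \<Rightarrow>\<^sub>0 rat\<close> whose support lies in \<open>S\<close>. A vector space depending on a subspace \<open>V\<close> cannot be a type,
  so quotients are carrier-based, as \<open>module\<close> records whose elements are cosets.
\<close>

definition qscale :: "rat \<Rightarrow> ('g \<Rightarrow>\<^sub>0 rat) \<Rightarrow> ('g \<Rightarrow>\<^sub>0 rat)"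
  where "qscale c x = Poly_Mapping.map ((*) c) x"

abbreviation qspan :: "('g \<Rightarrow>\<^sub>0 rat) set \<Rightarrow> ('g \<Rightarrow>\<^sub>0 rat) set"
  where "qspan \<equiv> module.span qscale"

definition free_on :: "'g set \<Rightarrow> ('g \<Rightarrow>\<^sub>0 rat) set"
  where "free_on S = {x. Poly_Mapping.keys x \<subseteq> S}"

abbreviation gen :: "'g \<Rightarrow> ('g \<Rightarrow>\<^sub>0 rat)"
  where "gen g \<equiv> Poly_Mapping.single g 1"

definition coset :: "('g \<Rightarrow>\<^sub>0 rat) set \<Rightarrow> ('g \<Rightarrow>\<^sub>0 rat) \<Rightarrow> ('g \<Rightarrow>\<^sub>0 rat) set"
  where "coset R x = (\<lambda>r. x + r) ` R"

text \<open>The fields \<open>mult\<close> and \<open>one\<close> of a \<open>module\<close> record are irrelevant for modules.\<close>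

definition presented ::
    "'g set \<Rightarrow> ('g \<Rightarrow>\<^sub>0 rat) set \<Rightarrow> (rat, ('g \<Rightarrow>\<^sub>0 rat) set) module"
  where "presented S R =
    \<lparr>carrier = coset (qspan R) ` free_on S,
     mult = undefined,
     one = undefined,
     zero = qspan R,
     add = (\<lambda>X Y. {x + y | x y. x \<in> X \<and> y \<in> Y}),
     smult = (\<lambda>c X. \<Union>x\<in>X. coset (qspan R) (qscale c x))\<rparr>"

text \<open>
  The bilinear extension of a map on generators, and the map it induces on cosets. The zero of a
  presented space \<open>M\<close> is its subspace of relations, so \<open>coset \<zero>\<^bsub>M\<^esub>\<close> is the quotient map to \<open>M\<close>. The
  union over all representatives is a single coset whenever the map is well defined
  (see \<open>induced_coset\<close> below).
\<close>

definition bilinear_ext ::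
    "('g \<Rightarrow> 'h \<Rightarrow> 'k) \<Rightarrow> ('g \<Rightarrow>\<^sub>0 rat) \<Rightarrow> ('h \<Rightarrow>\<^sub>0 rat) \<Rightarrow> ('k \<Rightarrow>\<^sub>0 rat)"
  where "bilinear_ext f x y =
    (\<Sum>a\<in>Poly_Mapping.keys x. \<Sum>b\<in>Poly_Mapping.keys y.
       Poly_Mapping.single (f a b) (Poly_Mapping.lookup x a * Poly_Mapping.lookup y b))"

definition induced ::
    "(rat, ('k \<Rightarrow>\<^sub>0 rat) set) module \<Rightarrow> ('g \<Rightarrow> 'h \<Rightarrow> 'k)
      \<Rightarrow> ('g \<Rightarrow>\<^sub>0 rat) set \<Rightarrow> ('h \<Rightarrow>\<^sub>0 rat) set \<Rightarrow> ('k \<Rightarrow>\<^sub>0 rat) set"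
  where "induced M f X Y = (\<Union>x\<in>X. \<Union>y\<in>Y. coset \<zero>\<^bsub>M\<^esub> (bilinear_ext f x y))"

section \<open>Tensor products over the rationals\<close>

definition tensor_relations ::
    "(rat, 'a) module \<Rightarrow> (rat, 'b) module \<Rightarrow> ('a \<times> 'b \<Rightarrow>\<^sub>0 rat) set"
  where "tensor_relations A B =
    {gen (x \<oplus>\<^bsub>A\<^esub> x', y) - gen (x, y) - gen (x', y) | x x' y.
       x \<in> carrier A \<and> x' \<in> carrier A \<and> y \<in> carrier B} \<union>
    {gen (x, y \<oplus>\<^bsub>B\<^esub> y') - gen (x, y) - gen (x, y') | x y y'.
       x \<in> carrier A \<and> y \<in> carrier B \<and> y' \<in> carrier B} \<union>
    {gen (c \<odot>\<^bsub>A\<^esub> x, y) - qscale c (gen (x, y)) | c x y. x \<in> carrier A \<and> y \<in> carrier B} \<union>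
    {gen (x, c \<odot>\<^bsub>B\<^esub> y) - qscale c (gen (x, y)) | c x y. x \<in> carrier A \<and> y \<in> carrier B}"

definition tensor ::
    "(rat, 'a) module \<Rightarrow> (rat, 'b) module \<Rightarrow> (rat, ('a \<times> 'b \<Rightarrow>\<^sub>0 rat) set) module"
  where "tensor A B = presented (carrier A \<times> carrier B) (tensor_relations A B)"

definition pure_tensor ::
    "(rat, 'a) module \<Rightarrow> (rat, 'b) module \<Rightarrow> 'a \<Rightarrow> 'b \<Rightarrow> ('a \<times> 'b \<Rightarrow>\<^sub>0 rat) set"
  where "pure_tensor A B x y = coset \<zero>\<^bsub>tensor A B\<^esub> (gen (x, y))"

section \<open>The Steinberg module\<close>

text \<open>
  \<open>V\<close> is a finite-dimensional subspace of an \<open>F\<close>-vector space with scalar multiplication \<open>s\<close>. The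
  presentation below also gives \<open>\<rat>\<close> in dimensions \<open>0\<close> and \<open>1\<close>.
\<close>

definition st_gens :: "('f::field \<Rightarrow> 'v::ab_group_add \<Rightarrow> 'v) \<Rightarrow> 'v set \<Rightarrow> 'v list set"
  where "st_gens s V = {vs. length vs = vector_space.dim s V \<and> set vs \<subseteq> V - {0}}"

definition st_relations ::
    "('f::field \<Rightarrow> 'v::ab_group_add \<Rightarrow> 'v) \<Rightarrow> 'v set \<Rightarrow> ('v list \<Rightarrow>\<^sub>0 rat) set"
  where "st_relations s V =
    {gen vs | vs. vs \<in> st_gens s V \<and> (\<not> distinct vs \<or> module.dependent s (set vs))} \<union>
    {gen (permute_list \<sigma> vs) - qscale (of_int (sign \<sigma>)) (gen vs) | \<sigma> vs.
       vs \<in> st_gens s V \<and> \<sigma> permutes {..<length vs}} \<union>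
    {gen (vs[i := s c (vs ! i)]) - gen vs | vs i c.
       vs \<in> st_gens s V \<and> i < length vs \<and> c \<noteq> 0} \<union>
    {\<Sum>i\<le>vector_space.dim s V. qscale ((-1) ^ i) (gen (take i ws @ drop (Suc i) ws)) | ws.
       length ws = Suc (vector_space.dim s V) \<and> set ws \<subseteq> V - {0}}"

definition St ::
    "('f::field \<Rightarrow> 'v::ab_group_add \<Rightarrow> 'v) \<Rightarrow> 'v set \<Rightarrow> (rat, ('v list \<Rightarrow>\<^sub>0 rat) set) module"
  where "St s V = presented (st_gens s V) (st_relations s V)"

definition apartment ::
    "('f::field \<Rightarrow> 'v::ab_group_add \<Rightarrow> 'v) \<Rightarrow> 'v set \<Rightarrow> 'v list \<Rightarrow> ('v list \<Rightarrow>\<^sub>0 rat) set"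
  where "apartment s V vs = coset \<zero>\<^bsub>St s V\<^esub> (gen vs)"

type_synonym 'v st_elt = "('v list \<Rightarrow>\<^sub>0 rat) set"
type_synonym 'v st2_elt = "('v st_elt \<times> 'v st_elt \<Rightarrow>\<^sub>0 rat) set"

definition St2 ::
    "('f::field \<Rightarrow> 'v::ab_group_add \<Rightarrow> 'v) \<Rightarrow> 'v set \<Rightarrow> (rat, 'v st2_elt) module"
  where "St2 s V = tensor (St s V) (St s V)"

abbreviation st_tensor ::
    "('f::field \<Rightarrow> 'v::ab_group_add \<Rightarrow> 'v) \<Rightarrow> 'v set \<Rightarrow> 'v st_elt \<Rightarrow> 'v st_elt \<Rightarrow> 'v st2_elt"
  where "st_tensor s V \<equiv> pure_tensor (St s V) (St s V)"

text \<open>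
  Both products take values in the space attached to \<open>V = V\<^sub>1 \<oplus> V\<^sub>2\<close>; the summands enter only through
  the arguments, which are elements of \<open>St s V\<^sub>1\<close>, \<open>St s V\<^sub>2\<close> and of \<open>St2 s V\<^sub>1\<close>, \<open>St2 s V\<^sub>2\<close>.
\<close>

definition st_mult ::
    "('f::field \<Rightarrow> 'v::ab_group_add \<Rightarrow> 'v) \<Rightarrow> 'v set \<Rightarrow> 'v st_elt \<Rightarrow> 'v st_elt \<Rightarrow> 'v st_elt"
  where "st_mult s V = induced (St s V) (@)"

definition st2_mult ::
    "('f::field \<Rightarrow> 'v::ab_group_add \<Rightarrow> 'v) \<Rightarrow> 'v set \<Rightarrow> 'v st2_elt \<Rightarrow> 'v st2_elt \<Rightarrow> 'v st2_elt"
  where "st2_mult s V =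
    induced (St2 s V) (\<lambda>(a1, b1) (a2, b2). (st_mult s V a1 a2, st_mult s V b1 b2))"

section \<open>Steinberg polylogarithms and iterated integrals\<close>

text \<open>A tuple \<open>v\<^sub>1, \<dots>, v\<^sub>d\<close> is a function on \<open>nat\<close> of which only the values on \<open>{1..d}\<close> matter.\<close>

definition is_basis ::
    "('f::field \<Rightarrow> 'v::ab_group_add \<Rightarrow> 'v) \<Rightarrow> 'v set \<Rightarrow> nat \<Rightarrow> (nat \<Rightarrow> 'v) \<Rightarrow> bool"
  where "is_basis s V d v \<longleftrightarrow>
    inj_on v {1..d} \<and> \<not> module.dependent s (v ` {1..d}) \<and> module.span s (v ` {1..d}) = V"

definition steinberg_L ::
    "('f::field \<Rightarrow> 'v::ab_group_add \<Rightarrow> 'v) \<Rightarrow> 'v set \<Rightarrow> nat \<Rightarrow> (nat \<Rightarrow> 'v) \<Rightarrow> 'v st2_elt"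
  where "steinberg_L s V d v =
    st_tensor s V
      (apartment s V (map (\<lambda>i. \<Sum>j=i..d. v j) (rev [1..<Suc d])))
      (apartment s V (map v (rev [1..<Suc d])))"

definition steinberg_I ::
    "('f::field \<Rightarrow> 'v::ab_group_add \<Rightarrow> 'v) \<Rightarrow> 'v set \<Rightarrow> nat \<Rightarrow> (nat \<Rightarrow> 'v) \<Rightarrow> 'v st2_elt"
  where "steinberg_I s V d v =
    (-1) ^ d \<odot>\<^bsub>St2 s V\<^esub>
    st_tensor s V
      (apartment s V (map v (rev [1..<Suc d])))
      (apartment s V (map (\<lambda>i. if i = d then v d else v i - v (Suc i)) (rev [1..<Suc d])))"

definition shuffle_perms :: "nat \<Rightarrow> nat \<Rightarrow> (nat \<Rightarrow> nat) set"
  where "shuffle_perms d1 d2 =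
    {\<sigma>. \<sigma> permutes {1..d1 + d2} \<and>
        strict_mono_on {1..d1} (inv_into UNIV \<sigma>) \<and> strict_mono_on {d1 + 1..d1 + d2} (inv_into UNIV \<sigma>)}"

section \<open>Well-definedness\<close>

lemma lookup_qscale [simp]: "Poly_Mapping.lookup (qscale c x) k = c * Poly_Mapping.lookup x k"
  by (simp add: qscale_def Poly_Mapping.map.rep_eq when_def)

interpretation qvs: vector_space "qscale :: rat \<Rightarrow> ('g \<Rightarrow>\<^sub>0 rat) \<Rightarrow> _"
  by unfold_locales (auto intro!: poly_mapping_eqI simp: lookup_add algebra_simps)

lemma qscale_single [simp]: "qscale c (Poly_Mapping.single a b) = Poly_Mapping.single a (c * b)"
  by (rule poly_mapping_eqI) (simp add: lookup_single when_def)

lemma subspace_free_on: "qvs.subspace (free_on S)"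
  unfolding qvs.subspace_def free_on_def
proof (intro conjI ballI allI)
  fix x y :: "'a \<Rightarrow>\<^sub>0 rat"
  assume "x \<in> {x. Poly_Mapping.keys x \<subseteq> S}" "y \<in> {x. Poly_Mapping.keys x \<subseteq> S}"
  then show "x + y \<in> {x. Poly_Mapping.keys x \<subseteq> S}"
    using Poly_Mapping.keys_add[of x y] by blast
next
  fix x :: "'a \<Rightarrow>\<^sub>0 rat" and c
  assume "x \<in> {x. Poly_Mapping.keys x \<subseteq> S}"
  then show "qscale c x \<in> {x. Poly_Mapping.keys x \<subseteq> S}"
    by (auto simp: in_keys_iff)
qed simp

lemma gen_free_on [simp]: "gen a \<in> free_on S \<longleftrightarrow> a \<in> S"
  by (simp add: free_on_def)

lemma free_on_induct [consumes 1, case_names zero gen add scale]: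
  assumes "x \<in> free_on S" "P 0" "\<And>a. a \<in> S \<Longrightarrow> P (gen a)"
    "\<And>x y. P x \<Longrightarrow> P y \<Longrightarrow> P (x + y)" "\<And>c x. P x \<Longrightarrow> P (qscale c x)"
  shows "P x"
proof -
  have "Poly_Mapping.keys x \<subseteq> S" using assms(1) by (simp add: free_on_def)
  then have "(\<Sum>k\<in>Poly_Mapping.keys x. qscale (Poly_Mapping.lookup x k) (gen k)) \<in> qspan (gen ` S)"
    by (intro qvs.span_sum qvs.span_scale qvs.span_base) auto
  moreover have "(\<Sum>k\<in>Poly_Mapping.keys x. qscale (Poly_Mapping.lookup x k) (gen k)) = x"
    by (rule poly_mapping_eqI) (simp add: lookup_sum lookup_single when_def in_keys_iff)
  ultimately have "x \<in> qspan (gen ` S)" by simp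
  then show ?thesis
    by (induction rule: qvs.span_induct_alt) (use assms in \<open>auto simp del: qscale_single\<close>)
qed

lemma mem_coset: "z \<in> coset R x \<longleftrightarrow> z - x \<in> R"
proof
  assume "z - x \<in> R"
  then have "x + (z - x) \<in> coset R x" unfolding coset_def by (rule imageI)
  then show "z \<in> coset R x" by simp
qed (auto simp: coset_def)

lemma coset_eq_iff: "coset (qspan R) x = coset (qspan R) y \<longleftrightarrow> x - y \<in> qspan R"
proof
  assume "coset (qspan R) x = coset (qspan R) y"
  then have "x \<in> coset (qspan R) y" using mem_coset[of x "qspan R" x] qvs.span_zero by simp
  then show "x - y \<in> qspan R" by (simp add: mem_coset)
next
  assume *: "x - y \<in> qspan R"
  have "z - x \<in> qspan R \<longleftrightarrow> z - y \<in> qspan R" for z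
    using qvs.span_add[OF _ *, of "z - x"] qvs.span_diff[OF _ *, of "z - y"] by auto
  then show "coset (qspan R) x = coset (qspan R) y" by (auto simp: mem_coset)
qed

lemma coset_zero: "coset R 0 = R"
  by (auto simp: coset_def)

lemma presented_simps:
  "carrier (presented S R) = coset (qspan R) ` free_on S"
  "\<zero>\<^bsub>presented S R\<^esub> = qspan R"
  by (simp_all add: presented_def)

lemma presented_add:
  "coset (qspan R) x \<oplus>\<^bsub>presented S R\<^esub> coset (qspan R) y = coset (qspan R) (x + y)"
proof -
  have "z \<in> coset (qspan R) (x + y) \<longleftrightarrow> (\<exists>a b. z = a + b \<and> a \<in> coset (qspan R) x \<and> b \<in> coset (qspan R) y)" for z
  proof
    assume "z \<in> coset (qspan R) (x + y)"
    then have "z = (z - y) + y" "z - y \<in> coset (qspan R) x" "y \<in> coset (qspan R) y"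
      by (auto simp: mem_coset algebra_simps qvs.span_zero)
    then show "\<exists>a b. z = a + b \<and> a \<in> coset (qspan R) x \<and> b \<in> coset (qspan R) y" by blast
  next
    assume "\<exists>a b. z = a + b \<and> a \<in> coset (qspan R) x \<and> b \<in> coset (qspan R) y"
    then obtain a b where "z = a + b" "a - x \<in> qspan R" "b - y \<in> qspan R" by (auto simp: mem_coset)
    moreover from this have "(a - x) + (b - y) \<in> qspan R" by (blast intro: qvs.span_add)
    ultimately show "z \<in> coset (qspan R) (x + y)" by (simp add: mem_coset algebra_simps)
  qed
  then show ?thesis by (auto simp: presented_def)
qed

lemma presented_smult:
  "c \<odot>\<^bsub>presented S R\<^esub> coset (qspan R) x = coset (qspan R) (qscale c x)"
proof -
  have "coset (qspan R) (qscale c y) = coset (qspan R) (qscale c x)"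
    if "y \<in> coset (qspan R) x" for y
    using that qvs.span_scale[of "y - x" R c]
    by (simp add: mem_coset coset_eq_iff qvs.scale_right_diff_distrib)
  moreover have "x \<in> coset (qspan R) x" by (simp add: mem_coset qvs.span_zero)
  ultimately have "(\<Union>y\<in>coset (qspan R) x. coset (qspan R) (qscale c y)) = coset (qspan R) (qscale c x)"
    by (intro SUP_eq_const) blast+
  then show ?thesis by (simp add: presented_def)
qed

lemma abelian_group_presented: "abelian_group (presented S R)"
proof (rule abelian_groupI)
  fix x assume "x \<in> carrier (presented S R)"
  then obtain a where a: "x = coset (qspan R) a" "a \<in> free_on S" by (auto simp: presented_simps)
  show "\<exists>y\<in>carrier (presented S R). y \<oplus>\<^bsub>presented S R\<^esub> x = \<zero>\<^bsub>presented S R\<^esub>"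
    by (rule bexI[of _ "coset (qspan R) (- a)"])
      (use a qvs.subspace_neg[OF subspace_free_on] in \<open>auto simp: presented_add coset_zero presented_simps\<close>)
next
  fix x assume "x \<in> carrier (presented S R)"
  then obtain a where a: "x = coset (qspan R) a" "a \<in> free_on S" by (auto simp: presented_simps)
  show "\<zero>\<^bsub>presented S R\<^esub> \<oplus>\<^bsub>presented S R\<^esub> x = x"
    using presented_add[where R = R and x = 0 and S = S and y = a] a by (simp add: coset_zero presented_simps)
next
  show "\<zero>\<^bsub>presented S R\<^esub> \<in> carrier (presented S R)"
    using qvs.subspace_0[OF subspace_free_on] by (force simp: presented_simps coset_zero image_iff)
qed (auto simp: presented_simps presented_add add_ac qvs.subspace_add[OF subspace_free_on])

lemma bilinear_ext_superset:
  assumes "finite A" "finite B" "Poly_Mapping.keys x \<subseteq> A" "Poly_Mapping.keys y \<subseteq> B"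
  shows "bilinear_ext f x y = (\<Sum>a\<in>A. \<Sum>b\<in>B.
       Poly_Mapping.single (f a b) (Poly_Mapping.lookup x a * Poly_Mapping.lookup y b))"
proof -
  have "bilinear_ext f x y = (\<Sum>a\<in>Poly_Mapping.keys x. \<Sum>b\<in>B.
       Poly_Mapping.single (f a b) (Poly_Mapping.lookup x a * Poly_Mapping.lookup y b))"
    unfolding bilinear_ext_def
    by (intro sum.cong refl sum.mono_neutral_left) (use assms in \<open>auto simp: in_keys_iff\<close>)
  also have "\<dots> = (\<Sum>a\<in>A. \<Sum>b\<in>B.
       Poly_Mapping.single (f a b) (Poly_Mapping.lookup x a * Poly_Mapping.lookup y b))"
    by (intro sum.mono_neutral_left) (use assms in \<open>auto simp: in_keys_iff\<close>)
  finally show ?thesis .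
qed

lemma bilinear_ext_zero [simp]: "bilinear_ext f 0 y = 0" "bilinear_ext f x 0 = 0"
  by (simp_all add: bilinear_ext_def)

lemma bilinear_ext_gen [simp]: "bilinear_ext f (gen a) (gen b) = gen (f a b)"
  by (simp add: bilinear_ext_def)

lemma bilinear_ext_add_left: "bilinear_ext f (x + x') y = bilinear_ext f x y + bilinear_ext f x' y"
proof -
  let ?A = "Poly_Mapping.keys x \<union> Poly_Mapping.keys x'" and ?B = "Poly_Mapping.keys y"
  have "Poly_Mapping.keys (x + x') \<subseteq> ?A" by (rule Poly_Mapping.keys_add)
  then show ?thesis
    by (simp add: bilinear_ext_superset[of ?A ?B] lookup_add distrib_right single_add sum.distrib)
qed

lemma bilinear_ext_add_right: "bilinear_ext f x (y + y') = bilinear_ext f x y + bilinear_ext f x y'"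
proof -
  let ?B = "Poly_Mapping.keys y \<union> Poly_Mapping.keys y'" and ?A = "Poly_Mapping.keys x"
  have "Poly_Mapping.keys (y + y') \<subseteq> ?B" by (rule Poly_Mapping.keys_add)
  then show ?thesis
    by (simp add: bilinear_ext_superset[of ?A ?B] lookup_add distrib_left single_add sum.distrib)
qed

lemma bilinear_ext_scale_left: "bilinear_ext f (qscale c x) y = qscale c (bilinear_ext f x y)"
proof -
  have "Poly_Mapping.keys (qscale c x) \<subseteq> Poly_Mapping.keys x" by (auto simp: in_keys_iff)
  then show ?thesis
    by (simp add: bilinear_ext_superset[of "Poly_Mapping.keys x" "Poly_Mapping.keys y"]
        qvs.scale_sum_right mult_ac)
qed

lemma bilinear_ext_scale_right: "bilinear_ext f x (qscale c y) = qscale c (bilinear_ext f x y)"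
proof -
  have "Poly_Mapping.keys (qscale c y) \<subseteq> Poly_Mapping.keys y" by (auto simp: in_keys_iff)
  then show ?thesis
    by (simp add: bilinear_ext_superset[of "Poly_Mapping.keys x" "Poly_Mapping.keys y"]
        qvs.scale_sum_right mult_ac)
qed

lemma bilinear_ext_diff_left: "bilinear_ext f (x - x') y = bilinear_ext f x y - bilinear_ext f x' y"
  using bilinear_ext_add_left[of f "x - x'" x' y] by simp

lemma bilinear_ext_diff_right: "bilinear_ext f x (y - y') = bilinear_ext f x y - bilinear_ext f x y'"
  using bilinear_ext_add_right[of f x "y - y'" y'] by simp

lemma bilinear_ext_sum_left: "bilinear_ext f (sum g I) y = (\<Sum>i\<in>I. bilinear_ext f (g i) y)"
  by (induction I rule: infinite_finite_induct) (auto simp: bilinear_ext_add_left)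

lemma bilinear_ext_sum_right: "bilinear_ext f x (sum g I) = (\<Sum>i\<in>I. bilinear_ext f x (g i))"
  by (induction I rule: infinite_finite_induct) (auto simp: bilinear_ext_add_right)

lemma bilinear_ext_span_left:
  assumes "\<And>r b. r \<in> R1 \<Longrightarrow> b \<in> S2 \<Longrightarrow> bilinear_ext f r (gen b) \<in> qspan R"
    and "x \<in> qspan R1" "y \<in> free_on S2"
  shows "bilinear_ext f x y \<in> qspan R"
  using assms(3)
proof (induction rule: free_on_induct)
  case (gen b)
  from assms(2) show ?case
    by (induction rule: qvs.span_induct_alt)
      (auto simp del: qscale_single simp: bilinear_ext_add_left bilinear_ext_scale_left
        intro!: qvs.span_add qvs.span_scale qvs.span_zero assms(1) gen)
qed (auto simp del: qscale_single simp: bilinear_ext_add_right bilinear_ext_scale_right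
    intro: qvs.span_add qvs.span_scale qvs.span_zero)

lemma bilinear_ext_span_right:
  assumes "\<And>a r. a \<in> S1 \<Longrightarrow> r \<in> R2 \<Longrightarrow> bilinear_ext f (gen a) r \<in> qspan R"
    and "x \<in> free_on S1" "y \<in> qspan R2"
  shows "bilinear_ext f x y \<in> qspan R"
  using assms(2)
proof (induction rule: free_on_induct)
  case (gen a)
  from assms(3) show ?case
    by (induction rule: qvs.span_induct_alt)
      (auto simp del: qscale_single simp: bilinear_ext_add_right bilinear_ext_scale_right
        intro!: qvs.span_add qvs.span_scale qvs.span_zero assms(1) gen)
qed (auto simp del: qscale_single simp: bilinear_ext_add_left bilinear_ext_scale_left
    intro: qvs.span_add qvs.span_scale qvs.span_zero)

lemma induced_coset:
  assumes "\<zero>\<^bsub>M\<^esub> = qspan R" "R1 \<subseteq> free_on S1"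
    and left: "\<And>r b. r \<in> R1 \<Longrightarrow> b \<in> S2 \<Longrightarrow> bilinear_ext f r (gen b) \<in> qspan R"
    and right: "\<And>a r. a \<in> S1 \<Longrightarrow> r \<in> R2 \<Longrightarrow> bilinear_ext f (gen a) r \<in> qspan R"
    and "x \<in> free_on S1" "y \<in> free_on S2"
  shows "induced M f (coset (qspan R1) x) (coset (qspan R2) y) = coset (qspan R) (bilinear_ext f x y)"
proof -
  have "coset (qspan R) (bilinear_ext f x' y') = coset (qspan R) (bilinear_ext f x y)"
    if "x' \<in> coset (qspan R1) x" "y' \<in> coset (qspan R2) y" for x' y'
  proof -
    have x': "x' - x \<in> qspan R1" and y': "y' - y \<in> qspan R2" using that by (auto simp: mem_coset)
    have "qspan R1 \<subseteq> free_on S1" using assms(2) by (rule qvs.span_minimal) (rule subspace_free_on)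
    with x' have "x' \<in> free_on S1"
      using qvs.subspace_add[OF subspace_free_on, of "x' - x" S1 x] assms by auto
    then have "bilinear_ext f x' (y' - y) \<in> qspan R"
      using bilinear_ext_span_right[OF right _ y'] by blast
    moreover have "bilinear_ext f (x' - x) y \<in> qspan R"
      using bilinear_ext_span_left[OF left x'] assms by blast
    ultimately have "bilinear_ext f x' (y' - y) + bilinear_ext f (x' - x) y \<in> qspan R"
      by (rule qvs.span_add)
    then show ?thesis by (simp add: coset_eq_iff bilinear_ext_diff_left bilinear_ext_diff_right)
  qed
  moreover have "x \<in> coset (qspan R1) x" "y \<in> coset (qspan R2) y"
    by (simp_all add: mem_coset qvs.span_zero)
  ultimately show ?thesis
    unfolding induced_def assms(1) by (intro SUP_eq_const) blast+
qed

lemma presented_add_closed: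
  assumes "x \<in> carrier (presented S R)" "y \<in> carrier (presented S R)"
  shows "x \<oplus>\<^bsub>presented S R\<^esub> y \<in> carrier (presented S R)"
  using assms by (auto simp: presented_simps presented_add intro!: imageI qvs.subspace_add[OF subspace_free_on])

lemma presented_smult_closed:
  assumes "x \<in> carrier (presented S R)"
  shows "c \<odot>\<^bsub>presented S R\<^esub> x \<in> carrier (presented S R)"
  using assms by (auto simp: presented_simps presented_smult intro!: imageI qvs.subspace_scale[OF subspace_free_on])

lemma pure_tensor_coset: "pure_tensor A B x y = coset (qspan (tensor_relations A B)) (gen (x, y))"
  by (simp add: pure_tensor_def tensor_def presented_simps)

lemma pure_tensor_closed:
  "x \<in> carrier A \<Longrightarrow> y \<in> carrier B \<Longrightarrow> pure_tensor A B x y \<in> carrier (tensor A B)"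
  by (auto simp: pure_tensor_coset tensor_def presented_simps)

lemma pure_tensor_add_left:
  assumes "x \<in> carrier A" "x' \<in> carrier A" "y \<in> carrier B"
  shows "pure_tensor A B (x \<oplus>\<^bsub>A\<^esub> x') y = pure_tensor A B x y \<oplus>\<^bsub>tensor A B\<^esub> pure_tensor A B x' y"
  unfolding pure_tensor_coset tensor_def presented_add coset_eq_iff
  by (rule qvs.span_base)
    (use assms in \<open>auto simp: tensor_relations_def diff_diff_eq[symmetric]\<close>)

lemma pure_tensor_add_right:
  assumes "x \<in> carrier A" "y \<in> carrier B" "y' \<in> carrier B"
  shows "pure_tensor A B x (y \<oplus>\<^bsub>B\<^esub> y') = pure_tensor A B x y \<oplus>\<^bsub>tensor A B\<^esub> pure_tensor A B x y'"
  unfolding pure_tensor_coset tensor_def presented_add coset_eq_iff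
  by (rule qvs.span_base)
    (use assms in \<open>auto simp: tensor_relations_def diff_diff_eq[symmetric]\<close>)

lemma pure_tensor_smult_left:
  assumes "x \<in> carrier A" "y \<in> carrier B"
  shows "pure_tensor A B (c \<odot>\<^bsub>A\<^esub> x) y = c \<odot>\<^bsub>tensor A B\<^esub> pure_tensor A B x y"
  unfolding pure_tensor_coset tensor_def presented_smult coset_eq_iff
  by (rule qvs.span_base) (use assms in \<open>auto simp: tensor_relations_def simp del: qscale_single\<close>)

lemma pure_tensor_smult_right:
  assumes "x \<in> carrier A" "y \<in> carrier B"
  shows "pure_tensor A B x (c \<odot>\<^bsub>B\<^esub> y) = c \<odot>\<^bsub>tensor A B\<^esub> pure_tensor A B x y"
  unfolding pure_tensor_coset tensor_def presented_smult coset_eq_iff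
  by (rule qvs.span_base) (use assms in \<open>auto simp: tensor_relations_def simp del: qscale_single\<close>)

lemma tensor_relationsI:
  "x \<in> carrier A \<Longrightarrow> x' \<in> carrier A \<Longrightarrow> y \<in> carrier B \<Longrightarrow>
    gen (x \<oplus>\<^bsub>A\<^esub> x', y) - gen (x, y) - gen (x', y) \<in> tensor_relations A B"
  "x \<in> carrier A \<Longrightarrow> y \<in> carrier B \<Longrightarrow> y' \<in> carrier B \<Longrightarrow>
    gen (x, y \<oplus>\<^bsub>B\<^esub> y') - gen (x, y) - gen (x, y') \<in> tensor_relations A B"
  "x \<in> carrier A \<Longrightarrow> y \<in> carrier B \<Longrightarrow>
    gen (c \<odot>\<^bsub>A\<^esub> x, y) - qscale c (gen (x, y)) \<in> tensor_relations A B"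
  "x \<in> carrier A \<Longrightarrow> y \<in> carrier B \<Longrightarrow>
    gen (x, c \<odot>\<^bsub>B\<^esub> y) - qscale c (gen (x, y)) \<in> tensor_relations A B"
  unfolding tensor_relations_def by blast+

lemma tensor_relations_free_on:
  "tensor_relations (presented S R) (presented S' R')
    \<subseteq> free_on (carrier (presented S R) \<times> carrier (presented S' R'))"
  unfolding tensor_relations_def
  by (auto simp del: qscale_single intro!: qvs.subspace_diff[OF subspace_free_on]
      qvs.subspace_scale[OF subspace_free_on] presented_add_closed presented_smult_closed)

lemma St_simps:
  "carrier (St s V) = coset (qspan (st_relations s V)) ` free_on (st_gens s V)"
  "\<zero>\<^bsub>St s V\<^esub> = qspan (st_relations s V)"
  "apartment s V vs = coset (qspan (st_relations s V)) (gen vs)"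
  by (simp_all add: St_def presented_simps apartment_def)

lemma permute_list_append_left:
  assumes "\<sigma> permutes {..<length a}"
  shows "permute_list \<sigma> (a @ b) = permute_list \<sigma> a @ b"
proof (rule nth_equalityI)
  fix i assume "i < length (permute_list \<sigma> (a @ b))"
  then show "permute_list \<sigma> (a @ b) ! i = (permute_list \<sigma> a @ b) ! i"
    using permutes_in_image[OF assms, of i] permutes_not_in[OF assms, of i]
    by (auto simp: permute_list_def nth_append)
qed simp

definition shift_perm :: "nat \<Rightarrow> (nat \<Rightarrow> nat) \<Rightarrow> nat \<Rightarrow> nat"
  where "shift_perm n \<sigma> i = (if i < n then i else n + \<sigma> (i - n))"

lemma shift_perm:
  assumes "\<sigma> permutes {..<m}"
  shows "shift_perm n \<sigma> permutes {..<n + m} \<and> sign (shift_perm n \<sigma>) = sign \<sigma>"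
  using finite_lessThan assms
proof (induction rule: permutes_rev_induct)
  case id
  have "shift_perm n (\<lambda>a. a) = (\<lambda>a. a)" by (auto simp: shift_perm_def)
  then show ?case using permutes_id sign_id by (simp add: id_def)
next
  case (swap a b \<sigma>)
  have eq: "shift_perm n (\<sigma> \<circ> transpose a b) = shift_perm n \<sigma> \<circ> transpose (n + a) (n + b)"
    by (auto simp: fun_eq_iff shift_perm_def transpose_def)
  have "permutation (shift_perm n \<sigma>)" "permutation \<sigma>"
    using swap permutation_permutes finite_lessThan by blast+
  then have "sign (shift_perm n \<sigma> \<circ> transpose (n + a) (n + b)) = sign (\<sigma> \<circ> transpose a b)"
    using swap by (simp only: sign_compose permutation_swap_id sign_swap_id) simp
  moreover have "shift_perm n \<sigma> \<circ> transpose (n + a) (n + b) permutes {..<n + m}"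
    by (rule permutes_compose[OF permutes_swap_id]) (use swap in auto)
  ultimately show ?case by (simp add: eq[unfolded comp_def] comp_def)
qed

lemma permute_list_append_right:
  assumes "\<sigma> permutes {..<length b}"
  shows "permute_list (shift_perm (length a) \<sigma>) (a @ b) = a @ permute_list \<sigma> b"
  by (rule nth_equalityI) (auto simp: permute_list_def nth_append shift_perm_def)

lemma sum_atMost_split:
  fixes f :: "nat \<Rightarrow> 'a::ab_group_add"
  shows "(\<Sum>i\<le>m + n. f i) = (\<Sum>i<m. f i) + (\<Sum>j\<le>n. f (m + j))"
  by (induction n) (simp_all add: add.assoc flip: lessThan_Suc_atMost)

abbreviation remove_at :: "nat \<Rightarrow> 'a list \<Rightarrow> 'a list"
  where "remove_at i ws \<equiv> take i ws @ drop (Suc i) ws"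

context vector_space
begin

lemma st_rel_dependent:
  assumes "vs \<in> st_gens scale V" "\<not> distinct vs \<or> dependent (set vs)"
  shows "gen vs \<in> qspan (st_relations scale V)"
  by (rule qvs.span_base) (use assms in \<open>auto simp: st_relations_def\<close>)

lemma st_rel_permute:
  assumes "vs \<in> st_gens scale V" "\<sigma> permutes {..<length vs}"
  shows "gen (permute_list \<sigma> vs) - qscale (of_int (sign \<sigma>)) (gen vs) \<in> qspan (st_relations scale V)"
  by (rule qvs.span_base) (use assms in \<open>auto simp: st_relations_def simp del: qscale_single\<close>)

lemma st_rel_scale:
  assumes "vs \<in> st_gens scale V" "i < length vs" "c \<noteq> 0"
  shows "gen (vs[i := scale c (vs ! i)]) - gen vs \<in> qspan (st_relations scale V)"
  by (rule qvs.span_base) (use assms in \<open>auto simp: st_relations_def\<close>)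

lemma st_rel_sum:
  assumes "length ws = Suc (dim V)" "set ws \<subseteq> V - {0}"
  shows "(\<Sum>i\<le>dim V. qscale ((-1) ^ i) (gen (remove_at i ws))) \<in> qspan (st_relations scale V)"
  by (rule qvs.span_base) (use assms in \<open>auto simp: st_relations_def simp del: qscale_single\<close>)

lemma too_many_dependent:
  assumes "finite B" "span B = V" "length ws = Suc (dim V)" "set ws \<subseteq> V"
  shows "\<not> distinct ws \<or> dependent (set ws)"
proof (rule ccontr)
  assume *: "\<not> ?thesis"
  obtain C where C: "C \<subseteq> V" "independent C" "V \<subseteq> span C" "card C = dim V"
    using basis_exists by blast
  have "finite C" using independent_span_bound[OF assms(1) C(2)] C assms by auto
  then have "card (set ws) \<le> card C"
    using independent_span_bound[of C "set ws"] * assms C by blast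
  with * assms C show False by (simp add: distinct_card)
qed

lemma remove_at_append:
  "i < length a \<Longrightarrow> remove_at i (a @ b) = remove_at i a @ b"
  "remove_at (length a + j) (a @ b) = a @ remove_at j b"
  by (simp_all add: Suc_diff_Suc)

lemma set_remove_at: "set (remove_at i ws) \<subseteq> set ws"
  by (auto dest: in_set_takeD in_set_dropD)

lemma st_relations_free_on:
  assumes "subspace V" shows "st_relations scale V \<subseteq> free_on (st_gens scale V)"
proof -
  have 1: "permute_list \<sigma> vs \<in> st_gens scale V" if "vs \<in> st_gens scale V" "\<sigma> permutes {..<length vs}" for \<sigma> vs
    using that by (auto simp: st_gens_def)
  have 2: "vs[i := scale c (vs ! i)] \<in> st_gens scale V"
    if "vs \<in> st_gens scale V" "i < length vs" "c \<noteq> 0" for i c vs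
  proof -
    have "vs ! i \<in> set vs" using that(2) by (rule nth_mem)
    then have "vs ! i \<in> V - {0}" using that unfolding st_gens_def by blast
    then have "scale c (vs ! i) \<in> V - {0}" using that subspace_scale[OF assms] by simp
    then show ?thesis using that set_update_subset_insert[of vs i "scale c (vs ! i)"]
      by (auto simp: st_gens_def)
  qed
  have 3: "remove_at i ws \<in> st_gens scale V"
    if "length ws = Suc (dim V)" "set ws \<subseteq> V - {0}" "i \<le> dim V" for i ws
    using that set_remove_at[of i ws] by (auto simp: st_gens_def)
  show ?thesis
    unfolding st_relations_def
    by (auto simp del: qscale_single set_append intro!: qvs.subspace_diff[OF subspace_free_on]
      qvs.subspace_scale[OF subspace_free_on] qvs.subspace_sum[OF subspace_free_on] 1 2 3)
qed

context
  fixes V V1 V2 B1 B2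
  assumes subs: "V1 \<subseteq> V" "V2 \<subseteq> V"
    and fd: "finite B1" "span B1 = V1" "finite B2" "span B2 = V2"
    and dims: "dim V = dim V1 + dim V2"
begin

lemma st_gens_append:
  "a \<in> st_gens scale V1 \<Longrightarrow> b \<in> st_gens scale V2 \<Longrightarrow> a @ b \<in> st_gens scale V"
  using subs by (auto simp: st_gens_def dims)

lemma append_rel_left:
  assumes r: "r \<in> st_relations scale V1" and b: "b \<in> st_gens scale V2"
  shows "bilinear_ext (@) r (gen b) \<in> qspan (st_relations scale V)"
proof -
  consider
    (dep) a where "r = gen a" "a \<in> st_gens scale V1" "\<not> distinct a \<or> dependent (set a)"
  | (perm) \<sigma> a where "r = gen (permute_list \<sigma> a) - qscale (of_int (sign \<sigma>)) (gen a)"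
      "a \<in> st_gens scale V1" "\<sigma> permutes {..<length a}"
  | (scal) a i c where "r = gen (a[i := scale c (a ! i)]) - gen a"
      "a \<in> st_gens scale V1" "i < length a" "c \<noteq> 0"
  | (sum) ws where "r = (\<Sum>i\<le>dim V1. qscale ((-1) ^ i) (gen (remove_at i ws)))"
      "length ws = Suc (dim V1)" "set ws \<subseteq> V1 - {0}"
    using r unfolding st_relations_def by blast
  then show ?thesis
  proof cases
    case dep
    then have "\<not> distinct (a @ b) \<or> dependent (set (a @ b))"
      using dependent_mono[of "set a" "set (a @ b)"] by auto
    with dep b show ?thesis by (simp add: st_rel_dependent st_gens_append del: set_append distinct_append)
  next
    case perm
    have p: "\<sigma> permutes {..<length (a @ b)}"
      by (rule permutes_subset[OF perm(3)]) auto
    have eq: "bilinear_ext (@) r (gen b)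
        = gen (permute_list \<sigma> (a @ b)) - qscale (of_int (sign \<sigma>)) (gen (a @ b))"
      by (simp add: perm(1) permute_list_append_left[OF perm(3)] bilinear_ext_diff_left
          bilinear_ext_scale_left del: qscale_single)
    show ?thesis
      unfolding eq by (rule st_rel_permute[OF st_gens_append[OF perm(2) b] p])
  next
    case scal
    have "gen ((a @ b)[i := scale c ((a @ b) ! i)]) - gen (a @ b) \<in> qspan (st_relations scale V)"
      by (rule st_rel_scale) (use scal b st_gens_append in auto)
    with scal show ?thesis by (simp add: bilinear_ext_diff_left nth_append list_update_append1)
  next
    case sum
    let ?f = "\<lambda>i. qscale ((-1) ^ i) (gen (remove_at i (ws @ b)))"
    have lb: "length b = dim V2" "set b \<subseteq> V2 - {0}" using b by (auto simp: st_gens_def)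
    have "(\<Sum>i\<le>dim V. ?f i) \<in> qspan (st_relations scale V)"
      by (rule st_rel_sum) (use sum lb subs in \<open>auto simp: dims\<close>)
    moreover have "?f i \<in> qspan (st_relations scale V)" if i: "i \<in> {..dim V} - {..dim V1}" for i
    proof -
      define j where "j = i - length ws"
      have j: "i = length ws + j" "j < dim V2" using i sum by (auto simp: j_def dims)
      then have eq: "remove_at i (ws @ b) = ws @ remove_at j b"
        by (simp only: remove_at_append)
      have "ws @ remove_at j b \<in> st_gens scale V"
        using sum lb j subs set_remove_at[of j b] by (auto simp: st_gens_def dims)
      moreover have "\<not> distinct ws \<or> dependent (set ws)"
        by (rule too_many_dependent[OF fd(1,2)]) (use sum in auto)
      then have "\<not> distinct (ws @ remove_at j b) \<or> dependent (set (ws @ remove_at j b))"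
        using dependent_mono[of "set ws" "set (ws @ remove_at j b)"] by auto
      ultimately show ?thesis
        unfolding eq by (intro qvs.span_scale st_rel_dependent)
    qed
    then have "(\<Sum>i\<in>{..dim V} - {..dim V1}. ?f i) \<in> qspan (st_relations scale V)"
      by (intro qvs.span_sum)
    moreover have "(\<Sum>i\<le>dim V. ?f i) = (\<Sum>i\<in>{..dim V} - {..dim V1}. ?f i) + (\<Sum>i\<le>dim V1. ?f i)"
      by (rule sum.subset_diff) (auto simp: dims)
    ultimately have "(\<Sum>i\<le>dim V1. ?f i) \<in> qspan (st_relations scale V)"
      using qvs.span_diff by fastforce
    moreover have "bilinear_ext (@) r (gen b) = (\<Sum>i\<le>dim V1. ?f i)"
      unfolding sum(1) bilinear_ext_sum_left bilinear_ext_scale_left bilinear_ext_gen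
      by (intro sum.cong refl) (use sum in \<open>simp add: remove_at_append(1)\<close>)
    ultimately show ?thesis by simp
  qed
qed

lemma append_rel_right:
  assumes a: "a \<in> st_gens scale V1" and r: "r \<in> st_relations scale V2"
  shows "bilinear_ext (@) (gen a) r \<in> qspan (st_relations scale V)"
proof -
  consider
    (dep) b where "r = gen b" "b \<in> st_gens scale V2" "\<not> distinct b \<or> dependent (set b)"
  | (perm) \<sigma> b where "r = gen (permute_list \<sigma> b) - qscale (of_int (sign \<sigma>)) (gen b)"
      "b \<in> st_gens scale V2" "\<sigma> permutes {..<length b}"
  | (scal) b i c where "r = gen (b[i := scale c (b ! i)]) - gen b"
      "b \<in> st_gens scale V2" "i < length b" "c \<noteq> 0"
  | (sum) ws where "r = (\<Sum>i\<le>dim V2. qscale ((-1) ^ i) (gen (remove_at i ws)))"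
      "length ws = Suc (dim V2)" "set ws \<subseteq> V2 - {0}"
    using r unfolding st_relations_def by blast
  then show ?thesis
  proof cases
    case dep
    then have "\<not> distinct (a @ b) \<or> dependent (set (a @ b))"
      using dependent_mono[of "set b" "set (a @ b)"] by auto
    with dep a show ?thesis by (simp add: st_rel_dependent st_gens_append del: set_append distinct_append)
  next
    case perm
    note sh = shift_perm[OF perm(3), of "length a"]
    have eq: "bilinear_ext (@) (gen a) r = gen (permute_list (shift_perm (length a) \<sigma>) (a @ b))
        - qscale (of_int (sign (shift_perm (length a) \<sigma>))) (gen (a @ b))"
      using sh by (simp add: perm(1) permute_list_append_right[OF perm(3)] bilinear_ext_diff_right
          bilinear_ext_scale_right del: qscale_single)
    show ?thesis
      unfolding eq by (rule st_rel_permute[OF st_gens_append[OF a perm(2)]]) (use sh in simp)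
  next
    case scal
    have "gen ((a @ b)[length a + i := scale c ((a @ b) ! (length a + i))]) - gen (a @ b)
        \<in> qspan (st_relations scale V)"
      by (rule st_rel_scale) (use scal a st_gens_append in auto)
    with scal show ?thesis by (simp add: bilinear_ext_diff_right list_update_append)
  next
    case sum
    let ?f = "\<lambda>i. qscale ((-1) ^ i) (gen (remove_at i (a @ ws)))"
    let ?n = "dim V1"
    have la: "length a = dim V1" "set a \<subseteq> V1 - {0}" using a by (auto simp: st_gens_def)
    have "(\<Sum>i\<le>dim V. ?f i) \<in> qspan (st_relations scale V)"
      by (rule st_rel_sum) (use sum la subs in \<open>auto simp: dims\<close>)
    moreover have "?f i \<in> qspan (st_relations scale V)" if i: "i < ?n" for i
    proof -
      have eq: "remove_at i (a @ ws) = remove_at i a @ ws"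
        by (rule remove_at_append) (use i la in simp)
      have "remove_at i a @ ws \<in> st_gens scale V"
        using sum la i subs set_remove_at[of i a] by (auto simp: st_gens_def dims)
      moreover have "\<not> distinct ws \<or> dependent (set ws)"
        by (rule too_many_dependent[OF fd(3,4)]) (use sum in auto)
      then have "\<not> distinct (remove_at i a @ ws) \<or> dependent (set (remove_at i a @ ws))"
        using dependent_mono[of "set ws" "set (remove_at i a @ ws)"] by auto
      ultimately show ?thesis
        unfolding eq by (intro qvs.span_scale st_rel_dependent)
    qed
    then have "(\<Sum>i<?n. ?f i) \<in> qspan (st_relations scale V)"
      by (intro qvs.span_sum) auto
    moreover have "(\<Sum>i\<le>dim V. ?f i) = (\<Sum>i<?n. ?f i) + (\<Sum>j\<le>dim V2. ?f (?n + j))"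
    unfolding dims by (rule sum_atMost_split)
    ultimately have "(\<Sum>j\<le>dim V2. ?f (?n + j)) \<in> qspan (st_relations scale V)"
      using qvs.span_diff by fastforce
    then have "qscale ((-1) ^ ?n) (\<Sum>j\<le>dim V2. ?f (?n + j)) \<in> qspan (st_relations scale V)"
      by (rule qvs.span_scale)
    moreover have "bilinear_ext (@) (gen a) r = qscale ((-1) ^ ?n) (\<Sum>j\<le>dim V2. ?f (?n + j))"
    proof -
      have "(-1) ^ ?n * (-1) ^ (?n + j) = ((-1) ^ j :: rat)" for j
        by (simp add: power_add flip: mult.assoc power_mult_distrib)
      moreover have "remove_at (?n + j) (a @ ws) = a @ remove_at j ws" for j
        unfolding la(1)[symmetric] by (rule remove_at_append(2))
      ultimately show ?thesis
        unfolding sum(1) bilinear_ext_sum_right bilinear_ext_scale_right bilinear_ext_gen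
          qvs.scale_sum_right qvs.scale_scale by simp
    qed
    ultimately show ?thesis by simp
  qed
qed

lemma st_mult_coset:
  assumes "x \<in> free_on (st_gens scale V1)" "y \<in> free_on (st_gens scale V2)"
  shows "st_mult scale V (coset (qspan (st_relations scale V1)) x) (coset (qspan (st_relations scale V2)) y)
    = coset (qspan (st_relations scale V)) (bilinear_ext (@) x y)"
  unfolding st_mult_def
  by (rule induced_coset[OF St_simps(2) st_relations_free_on append_rel_left append_rel_right])
    (use assms fd subspace_span in auto)

lemma st_mult_apartment:
  assumes "a \<in> st_gens scale V1" "b \<in> st_gens scale V2"
  shows "st_mult scale V (apartment scale V1 a) (apartment scale V2 b) = apartment scale V (a @ b)"
  using assms by (simp add: St_simps st_mult_coset)

lemma st_mult_closed:
  assumes "x \<in> carrier (St scale V1)" "y \<in> carrier (St scale V2)"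
  shows "st_mult scale V x y \<in> carrier (St scale V)"
proof -
  have "bilinear_ext (@) a b \<in> free_on (st_gens scale V)"
    if "a \<in> free_on (st_gens scale V1)" "b \<in> free_on (st_gens scale V2)" for a b
    using that(1)
  proof (induction rule: free_on_induct)
    case (gen g)
    from that(2) show ?case
      by (induction rule: free_on_induct)
        (use gen in \<open>auto simp: bilinear_ext_add_right bilinear_ext_scale_right st_gens_append
          intro: subspace_free_on[THEN qvs.subspace_0] subspace_free_on[THEN qvs.subspace_add]
            subspace_free_on[THEN qvs.subspace_scale]\<close>)
  qed (auto simp: bilinear_ext_add_left bilinear_ext_scale_left
        intro: subspace_free_on[THEN qvs.subspace_0] subspace_free_on[THEN qvs.subspace_add]
            subspace_free_on[THEN qvs.subspace_scale])
  with assms show ?thesis by (auto simp: St_simps st_mult_coset)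
qed

lemma St_ops:
  "coset (qspan (st_relations scale U)) a \<oplus>\<^bsub>St scale U\<^esub> coset (qspan (st_relations scale U)) b
    = coset (qspan (st_relations scale U)) (a + b)"
  "c \<odot>\<^bsub>St scale U\<^esub> coset (qspan (st_relations scale U)) a
    = coset (qspan (st_relations scale U)) (qscale c a)"
  by (simp_all add: St_def presented_add presented_smult)

lemma st_mult_bilinear:
  "x \<in> carrier (St scale V1) \<Longrightarrow> x' \<in> carrier (St scale V1) \<Longrightarrow> y \<in> carrier (St scale V2) \<Longrightarrow>
    st_mult scale V (x \<oplus>\<^bsub>St scale V1\<^esub> x') y
      = st_mult scale V x y \<oplus>\<^bsub>St scale V\<^esub> st_mult scale V x' y"
  "x \<in> carrier (St scale V1) \<Longrightarrow> y \<in> carrier (St scale V2) \<Longrightarrow> y' \<in> carrier (St scale V2) \<Longrightarrow>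
    st_mult scale V x (y \<oplus>\<^bsub>St scale V2\<^esub> y')
      = st_mult scale V x y \<oplus>\<^bsub>St scale V\<^esub> st_mult scale V x y'"
  "x \<in> carrier (St scale V1) \<Longrightarrow> y \<in> carrier (St scale V2) \<Longrightarrow>
    st_mult scale V (c \<odot>\<^bsub>St scale V1\<^esub> x) y = c \<odot>\<^bsub>St scale V\<^esub> st_mult scale V x y"
  "x \<in> carrier (St scale V1) \<Longrightarrow> y \<in> carrier (St scale V2) \<Longrightarrow>
    st_mult scale V x (c \<odot>\<^bsub>St scale V2\<^esub> y) = c \<odot>\<^bsub>St scale V\<^esub> st_mult scale V x y"
  by (auto simp: St_simps(1) St_ops st_mult_coset bilinear_ext_add_left bilinear_ext_add_right
      bilinear_ext_scale_left bilinear_ext_scale_right qvs.subspace_add[OF subspace_free_on]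
      qvs.subspace_scale[OF subspace_free_on])

lemma st2_mult_pure_tensor:
  assumes "x1 \<in> carrier (St scale V1)" "y1 \<in> carrier (St scale V1)"
    "x2 \<in> carrier (St scale V2)" "y2 \<in> carrier (St scale V2)"
  shows "st2_mult scale V (st_tensor scale V1 x1 y1) (st_tensor scale V2 x2 y2)
    = st_tensor scale V (st_mult scale V x1 x2) (st_mult scale V y1 y2)"
proof -
  let ?C1 = "carrier (St scale V1)" and ?C2 = "carrier (St scale V2)" and ?C = "carrier (St scale V)"
  let ?m = "st_mult scale V"
  let ?f = "\<lambda>(a1, b1) (a2, b2). (?m a1 a2, ?m b1 b2)"
  let ?T = "tensor_relations (St scale V) (St scale V)"
  note base = qvs.span_base[of _ ?T]
  have left: "bilinear_ext ?f r (gen p) \<in> qspan ?T"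
    if r: "r \<in> tensor_relations (St scale V1) (St scale V1)" and p: "p \<in> ?C2 \<times> ?C2" for r p
  proof -
    obtain a b where ab: "p = (a, b)" "a \<in> ?C2" "b \<in> ?C2" using p by auto
    have "bilinear_ext ?f r (gen p) \<in> ?T"
      using r unfolding tensor_relations_def[of "St scale V1"] Un_iff mem_Collect_eq
      by (elim disjE exE conjE)
        (auto simp del: qscale_single simp: bilinear_ext_diff_left bilinear_ext_scale_left
          st_mult_bilinear ab st_mult_closed intro: tensor_relationsI)
    then show ?thesis by (rule base)
  qed
  have right: "bilinear_ext ?f (gen p) r \<in> qspan ?T"
    if p: "p \<in> ?C1 \<times> ?C1" and r: "r \<in> tensor_relations (St scale V2) (St scale V2)" for r p
  proof -
    obtain a b where ab: "p = (a, b)" "a \<in> ?C1" "b \<in> ?C1" using p by auto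
    have "bilinear_ext ?f (gen p) r \<in> ?T"
      using r unfolding tensor_relations_def[of "St scale V2"] Un_iff mem_Collect_eq
      by (elim disjE exE conjE)
        (auto simp del: qscale_single simp: bilinear_ext_diff_right bilinear_ext_scale_right
          st_mult_bilinear ab st_mult_closed intro: tensor_relationsI)
    then show ?thesis by (rule base)
  qed
  have zero: "\<zero>\<^bsub>St2 scale V\<^esub> = qspan ?T"
    by (simp add: St2_def tensor_def presented_simps)
  have sub: "tensor_relations (St scale V1) (St scale V1) \<subseteq> free_on (?C1 \<times> ?C1)"
    unfolding St_def by (rule tensor_relations_free_on)
  show ?thesis
    unfolding st2_mult_def pure_tensor_coset
    by (subst induced_coset[OF zero sub left right]) (use assms in auto)
qed

end

end

end

theory Submission
  imports Defs
begin

text \<open>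
  Both factors of \<open>L\<close> and \<open>I\<close> are words in the letters \<open>v\<^sub>i\<close>: one factor is the word itself, the other
  consists of its partial sums or of its consecutive differences. A product is a pair of two blocks
  written one after the other. For the blocks of partial sums with totals \<open>x\<close> and \<open>y\<close>, the three-term
  relation \<open>[\<dots>, x, y] = [\<dots>, x, x + y] - [\<dots>, y, x + y]\<close> creates the common total \<open>x + y\<close> of all shuffles
  and splits them according to which block contributes the letter added last. For differences, the
  same relation for \<open>x - u\<close> and \<open>y - u\<close> splits the shuffles according to which block contributes the
  first letter after \<open>u\<close>. Both identities follow by induction. Rearranging both tensor
  factors by the same permutation produces no sign, so signs of shuffles never have to be computed.

  An apartment symbol extended by \<open>0\<close> to all lists satisfies its relations without
  side conditions, which makes the inductions purely formal.
\<close>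

section \<open>Shuffle identities for formal symbols\<close>


text \<open>This is multiplication by (-1)^n. It is phrased with negation because the values of a
  symbol lie in a bare abelian group, without scalars.\<close>

definition alt_sign :: "nat \<Rightarrow> 'a::ab_group_add \<Rightarrow> 'a"
  where "alt_sign n x = (if even n then x else - x)"

lemma alt_sign_simps [simp]:
  "alt_sign 0 x = x"
  "alt_sign (Suc n) x = - alt_sign n x"
  "alt_sign n (- x) = - alt_sign n x"
  "alt_sign n (alt_sign n x) = x"
  "alt_sign n (x + y) = alt_sign n x + alt_sign n y"
  "alt_sign n (x - y) = alt_sign n x - alt_sign n y"
  by (simp_all add: alt_sign_def)

locale steinberg_symbol =
  fixes \<alpha> :: "'v::ab_group_add list \<Rightarrow> 'w::ab_group_add"
  assumes swap: "\<alpha> (as @ x # y # bs) = - \<alpha> (as @ y # x # bs)"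
    and neg: "\<alpha> (as @ (- x) # bs) = \<alpha> (as @ x # bs)"
    and three_term: "\<alpha> (as @ x # y # bs) = \<alpha> (as @ x # (x + y) # bs) - \<alpha> (as @ y # (x + y) # bs)"
begin

section \<open>Rewriting rules for a single symbol\<close>

lemma move: "\<alpha> (as @ x # bs @ cs) = alt_sign (length bs) (\<alpha> (as @ bs @ x # cs))"
proof (induction bs arbitrary: as)
  case (Cons b bs)
  have "\<alpha> (as @ x # (b # bs) @ cs) = - \<alpha> ((as @ [b]) @ x # bs @ cs)"
    using swap[of as x b "bs @ cs"] by simp
  also have "\<dots> = - alt_sign (length bs) (\<alpha> ((as @ [b]) @ bs @ x # cs))"
    by (simp only: Cons.IH)
  finally show ?case by simp
qed simp

lemma move_back: "\<alpha> (as @ bs @ x # cs) = alt_sign (length bs) (\<alpha> (as @ x # bs @ cs))"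
  by (simp add: move)

text \<open>Moving \<open>x\<close> past \<open>bs\<close> makes it adjacent to \<open>y\<close>,
  where the three-term relation applies. Moving it back cancels the sign in the first term; in the
  last term \<open>x\<close> has disappeared, so the sign stays.\<close>

lemma split_sum:
  "\<alpha> (as @ x # bs @ y # cs)
    = \<alpha> (as @ x # bs @ (x + y) # cs) - alt_sign (length bs) (\<alpha> (as @ bs @ y # (x + y) # cs))"
  using three_term[of "as @ bs" x y cs] by (simp add: move)

lemma split_diff:
  "\<alpha> (as @ x # bs @ y # cs)
    = \<alpha> (as @ x # bs @ (y - x) # cs) - alt_sign (length bs) (\<alpha> (as @ y # (x - y) # bs @ cs))"
proof -
  \<comment> \<open>The three-term relation is applied to \<open>x\<close> and \<open>y - x\<close>,
    whose sum is \<open>y\<close>. A swap and a sign change then turn the pair \<open>y - x\<close>,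
    \<open>y\<close> into \<open>y\<close>, \<open>x - y\<close>.\<close>
  have "\<alpha> (as @ x # y # bs @ cs) = \<alpha> (as @ x # (y - x) # bs @ cs) + \<alpha> (as @ (y - x) # y # bs @ cs)"
    using three_term[of as x "y - x" "bs @ cs"] by simp
  also have "\<alpha> (as @ (y - x) # y # bs @ cs) = - \<alpha> (as @ y # (x - y) # bs @ cs)"
    using swap[of as "y - x" y "bs @ cs"] neg[of "as @ [y]" "x - y" "bs @ cs"] by simp
  finally show ?thesis
    using move_back[of "as @ [x]" bs y cs] move_back[of "as @ [x]" bs "y - x" cs] by simp
qed

end

text \<open>The total comes last, as in the first factor of \<open>L\<close>. Peeling off the first
  letter of a word therefore removes the last partial sum.\<close>

fun suffix_sums :: "'v::ab_group_add list \<Rightarrow> 'v list"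
  where
    "suffix_sums [] = []"
  | "suffix_sums (x # xs) = suffix_sums xs @ [sum_list (x # xs)]"

text \<open>The parameter \<open>u\<close> is the letter read just before the word. Starting with
  \<open>u = 0\<close> on the reversed word gives the second factor of \<open>I\<close>.\<close>

fun differences :: "'v::ab_group_add \<Rightarrow> 'v list \<Rightarrow> 'v list"
  where
    "differences u [] = []"
  | "differences u (x # xs) = (x - u) # differences x xs"

lemma length_suffix_sums [simp]: "length (suffix_sums xs) = length xs"
  by (induction xs) auto

lemma length_differences [simp]: "length (differences u xs) = length xs"
  by (induction xs arbitrary: u) auto

lemma sum_shuffles_Cons:
  assumes "x \<noteq> y"
  shows "(\<Sum>zs\<in>shuffles (x # xs) (y # ys). f zs)
    = (\<Sum>zs\<in>shuffles xs (y # ys). f (x # zs)) + (\<Sum>zs\<in>shuffles (x # xs) ys. f (y # zs))"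
proof -
  have "(\<Sum>zs\<in>shuffles (x # xs) (y # ys). f zs)
      = sum f ((#) x ` shuffles xs (y # ys)) + sum f ((#) y ` shuffles (x # xs) ys)"
    \<comment> \<open>Distinct first letters make the two families of shuffles disjoint, so the
      union becomes a sum.\<close>
    unfolding shuffles.simps by (rule sum.union_disjoint) (use assms in auto)
  then show ?thesis by (simp add: sum.reindex)
qed

lemma sum_list_map_shuffles:
  fixes v :: "'i \<Rightarrow> 'v::ab_group_add"
  shows "zs \<in> shuffles xs ys \<Longrightarrow> sum_list (map v zs) = sum_list (map v xs) + sum_list (map v ys)"
  by (induction xs ys arbitrary: zs rule: shuffles.induct) (auto simp: algebra_simps)

text \<open>This models the tensor product of two apartments as a function of both words, so that
  signs arising in one argument can be cancelled against signs in the other.\<close>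

locale steinberg_pairing =
  fixes \<Phi> :: "'v::ab_group_add list \<Rightarrow> 'v list \<Rightarrow> 'w::ab_group_add"
  assumes left: "steinberg_symbol (\<lambda>a. \<Phi> a b)"
    and right: "steinberg_symbol (\<Phi> a)"
begin

lemmas split_sum = steinberg_symbol.split_sum[OF left]
lemmas split_diff = steinberg_symbol.split_diff[OF right]
lemmas move_left = steinberg_symbol.move[OF left]
lemmas move_right = steinberg_symbol.move[OF right]

text \<open>Iterating the three-term relation on the total sums of the two blocks peels off the first letter of
  a shuffle. The reversed words in the second argument absorb the signs.\<close>

lemma shuffle_suffix_sums:
  assumes "distinct (xs @ ys)"
  shows "\<Phi> (suffix_sums (map v xs) @ suffix_sums (map v ys) @ as) (rev (map v xs) @ rev (map v ys) @ bs)
    = (\<Sum>zs\<in>shuffles xs ys. \<Phi> (suffix_sums (map v zs) @ as) (rev (map v zs) @ bs))"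
  using assms
proof (induction xs ys arbitrary: as bs rule: shuffles.induct)
  case (3 x xs y ys)
  let ?X = "sum_list (map v (x # xs))" and ?Y = "sum_list (map v (y # ys))"
  let ?P = "suffix_sums (map v xs)" and ?Q = "suffix_sums (map v ys)"
  have "(\<Sum>zs\<in>shuffles (x # xs) (y # ys). \<Phi> (suffix_sums (map v zs) @ as) (rev (map v zs) @ bs))
    = (\<Sum>zs\<in>shuffles xs (y # ys). \<Phi> (suffix_sums (map v zs) @ (?X + ?Y) # as) (rev (map v zs) @ v x # bs))
    + (\<Sum>zs\<in>shuffles (x # xs) ys. \<Phi> (suffix_sums (map v zs) @ (?X + ?Y) # as) (rev (map v zs) @ v y # bs))"
    using 3 by (subst sum_shuffles_Cons)
      (auto intro!: arg_cong2[where f = "(+)"] sum.cong simp: sum_list_map_shuffles algebra_simps)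
  \<comment> \<open>In both inductive hypotheses the accumulator \<open>as\<close> takes up the
    common total \<open>?X + ?Y\<close>, and \<open>bs\<close> takes up the letter just peeled
    off.\<close>
  also have "\<dots> = \<Phi> (?P @ ?Q @ ?Y # (?X + ?Y) # as) (rev (map v xs) @ rev (map v (y # ys)) @ v x # bs)
    + \<Phi> (?P @ ?X # ?Q @ (?X + ?Y) # as) (rev (map v xs) @ v x # rev (map v ys) @ v y # bs)"
    using 3 by (subst "3.IH"[symmetric], force, subst "3.IH"(2)[symmetric], force) simp
  \<comment> \<open>Moving \<open>v x\<close> past the reversed second block, of length
    \<open>length ys + 1\<close>, gives exactly the sign that \<open>split_sum\<close> leaves in
    front of its last term.\<close>
  also have "\<dots> = \<Phi> (?P @ ?X # ?Q @ ?Y # as) (rev (map v xs) @ v x # rev (map v ys) @ v y # bs)"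
    using move_right[of "?P @ ?Q @ ?Y # (?X + ?Y) # as" "rev (map v xs)" "v x"
        "rev (map v (y # ys))" bs]
      split_sum[of ?P ?X ?Q ?Y as "rev (map v xs) @ v x # rev (map v ys) @ v y # bs"]
    by simp
  finally show ?case by simp
qed auto

text \<open>Once a first letter is chosen, both remaining blocks are measured from it, so
  \<open>u\<close> must vary in the induction. \<open>split_diff\<close> for \<open>v x - u\<close>
  and \<open>v y - u\<close> produces the new differences \<open>v y - v x\<close> and
  \<open>v x - v y\<close>.\<close>

lemma shuffle_differences:
  assumes "distinct (xs @ ys)"
  shows "\<Phi> (as @ map v xs @ map v ys) (bs @ differences u (map v xs) @ differences u (map v ys))
    = (\<Sum>zs\<in>shuffles xs ys. \<Phi> (as @ map v zs) (bs @ differences u (map v zs)))"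
  using assms
proof (induction xs ys arbitrary: as bs u rule: shuffles.induct)
  case (3 x xs y ys)
  let ?D = "differences (v x) (map v xs)" and ?E = "differences (v y) (map v ys)"
  have "(\<Sum>zs\<in>shuffles (x # xs) (y # ys). \<Phi> (as @ map v zs) (bs @ differences u (map v zs)))
    = (\<Sum>zs\<in>shuffles xs (y # ys). \<Phi> ((as @ [v x]) @ map v zs) ((bs @ [v x - u]) @ differences (v x) (map v zs)))
    + (\<Sum>zs\<in>shuffles (x # xs) ys. \<Phi> ((as @ [v y]) @ map v zs) ((bs @ [v y - u]) @ differences (v y) (map v zs)))"
    using 3 by (subst sum_shuffles_Cons) auto
  also have "\<dots> = \<Phi> (as @ v x # map v xs @ v y # map v ys) (bs @ (v x - u) # ?D @ (v y - v x) # ?E)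
    + \<Phi> (as @ v y # map v (x # xs) @ map v ys) (bs @ (v y - u) # (v x - v y) # ?D @ ?E)"
    using 3 by (subst "3.IH"[symmetric], force, subst "3.IH"(2)[symmetric], force) simp
  \<comment> \<open>The sign in \<open>split_diff\<close> is cancelled by moving \<open>v y\<close>
    past the first block in the left argument.\<close>
  also have "\<dots> = \<Phi> (as @ v x # map v xs @ v y # map v ys) (bs @ (v x - u) # ?D @ (v y - u) # ?E)"
    using move_left[of as "v y" "map v (x # xs)" "map v ys"]
    by (simp add: split_diff[of _ bs "v x - u" ?D "v y - u" ?E])
  finally show ?case by simp
qed auto

end

section \<open>Shuffles and shuffle permutations\<close>

declare upt_Suc [simp del]
text \<open>For disjoint alphabets each letter reveals its source, so a shuffle is recognised by its
  two restrictions. This replaces the recursion for \<open>shuffles\<close> by conditions on the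
  order of letters.\<close>

lemma in_shuffles_iff_filter:
  assumes "set xs \<inter> set ys = {}" "set zs = set xs \<union> set ys"
  shows "zs \<in> shuffles xs ys
    \<longleftrightarrow> filter (\<lambda>z. z \<in> set xs) zs = xs \<and> filter (\<lambda>z. z \<in> set ys) zs = ys"
proof -
  have "filter (\<lambda>z. z \<notin> set xs) zs = filter (\<lambda>z. z \<in> set ys) zs"
    by (rule filter_cong) (use assms in auto)
  then show ?thesis
    using filter_shuffles_disjoint1[OF assms(1)] partition_in_shuffles[of zs "\<lambda>z. z \<in> set xs"]
    by auto
qed

text \<open>Restriction to an alphabet commutes with reversal. The reversed form is needed for
  \<open>I\<close>, whose words are read from the last letter down.\<close>

lemma rev_shuffles:
  assumes "set xs \<inter> set ys = {}"
  shows "shuffles (rev xs) (rev ys) = rev ` shuffles xs ys"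
proof -
  have "rev zs \<in> shuffles (rev xs) (rev ys) \<longleftrightarrow> zs \<in> shuffles xs ys" for zs
  proof (cases "set zs = set xs \<union> set ys")
    case True
    then show ?thesis using assms by (simp add: in_shuffles_iff_filter flip: rev_filter)
  qed (use set_shuffles[of "rev zs" "rev xs" "rev ys"] set_shuffles[of zs xs ys] in auto)
  then show ?thesis by (metis image_iff rev_rev_ident subset_antisym subsetI)
qed

lemma filter_map_permutes_eq_upt_iff:
  assumes \<sigma>: "\<sigma> permutes {1..d}" and A: "{p..<q} \<subseteq> {1..d}"
  shows "filter (\<lambda>i. i \<in> {p..<q}) (map \<sigma> [1..<Suc d]) = [p..<q]
    \<longleftrightarrow> strict_mono_on {p..<q} (inv_into UNIV \<sigma>)"
proof -
  \<comment> \<open>These are the positions of the letters from the interval, in increasing order.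
    As a set they are the image of the interval under the inverse of \<sigma>, because the interval
    lies in \<open>{1..d}\<close>.\<close>
  define js where "js = filter (\<lambda>i. \<sigma> i \<in> {p..<q}) [1..<Suc d]"
  have js: "sorted_wrt (<) js" "set js = inv_into UNIV \<sigma> ` {p..<q}"
  proof -
    show "sorted_wrt (<) js" unfolding js_def by (intro sorted_wrt_filter) simp
    have "i \<in> {1..d}" if "\<sigma> i \<in> {p..<q}" for i
      using that A permutes_in_image[OF \<sigma>, of i] by blast
    then have "set js = \<sigma> -` {p..<q}" by (auto simp: js_def less_Suc_eq_le)
    then show "set js = inv_into UNIV \<sigma> ` {p..<q}"
      by (simp only: bij_vimage_eq_inv_image[OF permutes_bij[OF \<sigma>]])
  qed
  have "filter (\<lambda>i. i \<in> {p..<q}) (map \<sigma> [1..<Suc d]) = map \<sigma> js"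
    by (simp only: js_def filter_map comp_def)
  moreover have "map \<sigma> js = [p..<q] \<longleftrightarrow> sorted_wrt (<) (map \<sigma> js)"
  proof
    assume *: "sorted_wrt (<) (map \<sigma> js)"
    \<comment> \<open>The restricted word contains exactly the letters of the interval, so it equals
      \<open>[p..<q]\<close> as soon as it is increasing.\<close>
    have "set (map \<sigma> js) = {p..<q}"
      by (simp add: js image_image permutes_inverses[OF \<sigma>])
    with * show "map \<sigma> js = [p..<q]"
      by (intro sorted_distinct_set_unique) (auto simp: strict_sorted_iff)
  next
    assume "map \<sigma> js = [p..<q]"
    then show "sorted_wrt (<) (map \<sigma> js)" by simp
  qed
  moreover have "sorted_wrt (<) (map \<sigma> js) \<longleftrightarrow> strict_mono_on {p..<q} (inv_into UNIV \<sigma>)"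
  proof
    assume *: "strict_mono_on {p..<q} (inv_into UNIV \<sigma>)"
    have "\<sigma> i < \<sigma> j" if "i \<in> set js" "j \<in> set js" "i < j" for i j
    proof -
      have "\<sigma> i \<in> {p..<q}" "\<sigma> j \<in> {p..<q}" using that by (auto simp: js_def)
      then show ?thesis
        using strict_mono_on_less[OF *, of "\<sigma> i" "\<sigma> j"] that by (simp add: permutes_inverses[OF \<sigma>])
    qed
    then show "sorted_wrt (<) (map \<sigma> js)"
      unfolding sorted_wrt_map using js(1) by (rule sorted_wrt_mono_rel)
  next
    assume *: "sorted_wrt (<) (map \<sigma> js)"
    show "strict_mono_on {p..<q} (inv_into UNIV \<sigma>)"
    proof (rule strict_mono_onI, rule ccontr)
      fix a b assume ab: "a \<in> {p..<q}" "b \<in> {p..<q}" "a < b" "\<not> inv_into UNIV \<sigma> a < inv_into UNIV \<sigma> b"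
      then have "inv_into UNIV \<sigma> a \<in> set js" "inv_into UNIV \<sigma> b \<in> set js" by (simp_all add: js(2))
      then obtain k l where kl: "k < length js" "l < length js"
          "js ! k = inv_into UNIV \<sigma> a" "js ! l = inv_into UNIV \<sigma> b"
        unfolding in_set_conv_nth by blast
      then have \<sigma>kl: "\<sigma> (js ! k) = a" "\<sigma> (js ! l) = b"
        by (simp_all add: permutes_inverses[OF \<sigma>])
      have mono: "js ! i < js ! j" "\<sigma> (js ! i) < \<sigma> (js ! j)" if "i < j" "j < length js" for i j
        using that js(1) * unfolding sorted_wrt_map sorted_wrt_iff_nth_less by auto
      show False
        using linorder_less_linear[of k l] mono[of k l] mono[of l k] ab kl(1,2) \<sigma>kl
        unfolding kl(3,4)[symmetric] by auto
    qed
  qed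
  ultimately show ?thesis by simp
qed

lemma shuffle_perms_iff:
  assumes "\<sigma> permutes {1..d1 + d2}"
  shows "\<sigma> \<in> shuffle_perms d1 d2
    \<longleftrightarrow> map \<sigma> [1..<Suc (d1 + d2)] \<in> shuffles [1..<Suc d1] [Suc d1..<Suc (d1 + d2)]"
proof -
  have eq: "{1..d1} = {1..<Suc d1}" "{d1 + 1..d1 + d2} = {Suc d1..<Suc (d1 + d2)}" by auto
  have "set (map \<sigma> [1..<Suc (d1 + d2)]) = \<sigma> ` {1..d1 + d2}"
    by (simp only: set_map set_upt atLeastLessThanSuc_atLeastAtMost)
  then have "set (map \<sigma> [1..<Suc (d1 + d2)]) = set [1..<Suc d1] \<union> set [Suc d1..<Suc (d1 + d2)]"
    using permutes_image[OF assms] by auto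
  then have "map \<sigma> [1..<Suc (d1 + d2)] \<in> shuffles [1..<Suc d1] [Suc d1..<Suc (d1 + d2)] \<longleftrightarrow>
     filter (\<lambda>i. i \<in> {1..<Suc d1}) (map \<sigma> [1..<Suc (d1 + d2)]) = [1..<Suc d1] \<and>
     filter (\<lambda>i. i \<in> {Suc d1..<Suc (d1 + d2)}) (map \<sigma> [1..<Suc (d1 + d2)]) = [Suc d1..<Suc (d1 + d2)]"
    by (subst in_shuffles_iff_filter) (auto simp only: set_upt, auto)
  also have "\<dots> \<longleftrightarrow> strict_mono_on {1..<Suc d1} (inv_into UNIV \<sigma>)
      \<and> strict_mono_on {Suc d1..<Suc (d1 + d2)} (inv_into UNIV \<sigma>)"
    by (intro arg_cong2[where f = "(\<and>)"] filter_map_permutes_eq_upt_iff[OF assms]) auto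
  finally show ?thesis
    using assms by (simp only: shuffle_perms_def eq mem_Collect_eq simp_thms)
qed

lemma bij_betw_shuffle_perms:
  "bij_betw (\<lambda>\<sigma>. map \<sigma> [1..<Suc (d1 + d2)]) (shuffle_perms d1 d2)
    (shuffles [1..<Suc d1] [Suc d1..<Suc (d1 + d2)])"
  (is "bij_betw ?m ?P ?S")
  unfolding bij_betw_def
proof
  have perm: "\<sigma> permutes {1..d1 + d2}" if "\<sigma> \<in> ?P" for \<sigma>
    using that by (simp add: shuffle_perms_def)
  show "inj_on ?m ?P"
  proof (rule inj_onI, rule ext)
    fix \<sigma> \<tau> i assume *: "\<sigma> \<in> ?P" "\<tau> \<in> ?P" "?m \<sigma> = ?m \<tau>"
    show "\<sigma> i = \<tau> i"
    proof (cases "i \<in> {1..d1 + d2}")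
      case True
      then have "i \<in> set [1..<Suc (d1 + d2)]" by auto
      with *(3) show ?thesis unfolding map_eq_conv by blast
    qed (use perm[OF *(1)] perm[OF *(2)] in \<open>simp add: permutes_not_in\<close>)
  qed
  show "?m ` ?P = ?S"
  proof
    show "?m ` ?P \<subseteq> ?S" using perm shuffle_perms_iff by blast
    show "?S \<subseteq> ?m ` ?P"
    proof
      fix w assume w: "w \<in> ?S"
      then have len: "length w = d1 + d2" and set: "set w = {1..d1 + d2}"
        using length_shuffles[OF w] set_shuffles[OF w] by auto
      have dist: "distinct w" by (rule distinct_disjoint_shuffles[OF _ _ _ w]) auto
      \<comment> \<open>The word is read as a permutation. Letters are numbered from 1 and list
        positions from 0, hence \<open>i - 1\<close>; outside \<open>{1..d1 + d2}\<close> the map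
        must be the identity to satisfy \<open>permutes\<close>.\<close>
      define \<sigma> where "\<sigma> i = (if i \<in> {1..d1 + d2} then w ! (i - 1) else i)" for i
      have m: "?m \<sigma> = w" by (rule nth_equalityI) (auto simp: len \<sigma>_def)
      have "\<sigma> permutes {1..d1 + d2}"
      proof (rule bij_imp_permutes)
        have "\<sigma> ` {1..d1 + d2} = set (?m \<sigma>)" by (auto)
        then have "\<sigma> ` {1..d1 + d2} = {1..d1 + d2}" by (simp only: m set)
        then show "bij_betw \<sigma> {1..d1 + d2} {1..d1 + d2}"
          by (simp add: bij_betw_def eq_card_imp_inj_on)
      qed (auto simp: \<sigma>_def)
      with w m show "w \<in> ?m ` ?P" by (metis shuffle_perms_iff image_eqI)
    qed
  qed
qed

lemma sum_shuffles_eq_sum_shuffle_perms: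
  "(\<Sum>zs\<in>shuffles [1..<Suc d1] [Suc d1..<Suc (d1 + d2)]. f zs)
    = (\<Sum>\<sigma>\<in>shuffle_perms d1 d2. f (map \<sigma> [1..<Suc (d1 + d2)]))"
  by (rule sum.reindex_bij_betw[OF bij_betw_shuffle_perms, symmetric])

lemma sum_rev_shuffles_eq_sum_shuffle_perms:
  "(\<Sum>zs\<in>shuffles (rev [1..<Suc d1]) (rev [Suc d1..<Suc (d1 + d2)]). f zs)
    = (\<Sum>\<sigma>\<in>shuffle_perms d1 d2. f (map \<sigma> (rev [1..<Suc (d1 + d2)])))"
proof -
  have "(\<Sum>zs\<in>shuffles (rev [1..<Suc d1]) (rev [Suc d1..<Suc (d1 + d2)]). f zs)
    = (\<Sum>zs\<in>shuffles [1..<Suc d1] [Suc d1..<Suc (d1 + d2)]. f (rev zs))"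
    by (subst rev_shuffles) (auto simp: sum.reindex)
  then show ?thesis by (simp only: sum_shuffles_eq_sum_shuffle_perms rev_map)
qed

lemma finite_shuffle_perms: "finite (shuffle_perms d1 d2)"
  using bij_betw_finite[OF bij_betw_shuffle_perms] by blast

section \<open>Apartments as symbols\<close>

lemma finsum_presented:
  assumes "finite I" "\<And>i. i \<in> I \<Longrightarrow> f i \<in> free_on S"
  shows "(\<Oplus>\<^bsub>presented S R\<^esub> i\<in>I. coset (qspan R) (f i)) = coset (qspan R) (\<Sum>i\<in>I. f i)"
proof -
  interpret abelian_group "presented S R" by (rule abelian_group_presented)
  show ?thesis
    using assms
    by (induction I) (auto simp: presented_simps presented_add coset_zero
        finsum_insert Pi_iff)
qed

context vector_space
begin

text \<open>Applied to the span of the tensor relations, this realises the quotient inside a type: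
  equality of cosets becomes equality of values, and the abstract shuffle identities apply to those
  values.\<close>

lemma exists_linear_with_kernel:
  assumes "subspace U"
  shows "\<exists>f. Vector_Spaces.linear scale scale f \<and> (\<forall>x. f x = 0 \<longleftrightarrow> x \<in> U)"
proof -
  interpret vector_space_pair scale scale by unfold_locales
  obtain B where B: "B \<subseteq> U" "independent B" "U \<subseteq> span B"
    by (rule maximal_independent_subset)
  obtain C where C: "B \<subseteq> C" "independent C" "UNIV \<subseteq> span C"
    by (rule maximal_independent_subset_extend[OF subset_UNIV B(2)])
  \<comment> \<open>A basis \<open>B\<close> of \<open>U\<close> is extended to a basis
    \<open>C\<close> of the whole space; \<open>f\<close> is the projection that kills
    \<open>B\<close> and fixes \<open>C - B\<close>.\<close>
  obtain f where f: "Vector_Spaces.linear scale scale f" "\<forall>x\<in>C. f x = (if x \<in> B then 0 else x)"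
    using linear_independent_extend[OF C(2), of "\<lambda>x. if x \<in> B then 0 else x"] by blast
  have B0: "f x = 0" if "x \<in> span B" for x
    by (rule linear_eq_0_on_span[OF f(1) _ that]) (use f(2) C(1) in auto)
  have C0: "f x = x" if "x \<in> span (C - B)" for x
    by (rule linear_eq_on_span[OF f(1) linear_ident _ that]) (use f(2) in auto)
  have "f x = 0 \<longleftrightarrow> x \<in> U" for x
  proof
    assume "f x = 0"
    have "B \<union> (C - B) = C" using C(1) by blast
    then have "x \<in> span (B \<union> (C - B))" using C(3) by auto
    then obtain b c where bc: "x = b + c" "b \<in> span B" "c \<in> span (C - B)"
      unfolding span_Un by blast
    then have "c = 0" using \<open>f x = 0\<close> B0 C0 linear_add[OF f(1), of b c] by simp
    then show "x \<in> U" using bc span_minimal[OF B(1) assms] by auto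
  next
    assume "x \<in> U"
    then show "f x = 0" using B0 B(3) by blast
  qed
  with f(1) show ?thesis by blast
qed

section \<open>Consequences of the relations between apartments\<close>

lemma dependent_sum_triple:
  assumes "{x, y, x + y} \<subseteq> set vs" and "y \<noteq> 0" "x \<noteq> 0"
  shows "dependent (set vs)"
proof -
  \<comment> \<open>Since \<open>x\<close> and \<open>y\<close> are nonzero, both differ from
    \<open>x + y\<close> and remain in the set after its removal.\<close>
  have "x + y \<in> span (set vs - {x + y})"
    using assms by (intro span_add span_base) auto
  with assms show ?thesis unfolding dependent_def by blast
qed

lemma st_rel_swap:
  assumes "as @ x # y # bs \<in> st_gens scale V"
  shows "gen (as @ y # x # bs) + gen (as @ x # y # bs) \<in> qspan (st_relations scale V)"
proof -
  let ?vs = "as @ x # y # bs" and ?\<sigma> = "transpose (length as) (Suc (length as))"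
  have perm: "?\<sigma> permutes {..<length ?vs}" by (rule permutes_swap_id) auto
  have "permute_list ?\<sigma> ?vs = as @ y # x # bs"
  proof (rule nth_equalityI)
    fix i assume i: "i < length (permute_list ?\<sigma> ?vs)"
    consider "i < length as" | "i = length as" | "i = Suc (length as)"
      | j where "i = length as + Suc (Suc j)"
      by (metis add.right_neutral add_Suc_right less_imp_add_positive linorder_neqE_nat not0_implies_Suc not_gr_zero)
    then have "?vs ! ?\<sigma> i = (as @ y # x # bs) ! i"
      by cases (simp_all add: nth_append transpose_def)
    with i show "permute_list ?\<sigma> ?vs ! i = (as @ y # x # bs) ! i"
      by (simp only: permute_list_nth[OF perm] length_permute_list)
  qed simp
  then show ?thesis
    using st_rel_permute[OF assms perm] by (simp add: sign_swap_id single_uminus)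
qed

lemma st_rel_neg:
  assumes "as @ x # bs \<in> st_gens scale V"
  shows "gen (as @ (- x) # bs) - gen (as @ x # bs) \<in> qspan (st_relations scale V)"
  using st_rel_scale[OF assms, of "length as" "- 1"] by simp

text \<open>In the alternating relation for the list with \<open>x\<close>, \<open>y\<close>,
  \<open>x + y\<close> inserted between \<open>as\<close> and \<open>bs\<close>, omitting any other
  entry leaves this dependent triple. Only the three terms omitting one of its members
  survive.\<close>

lemma st_rel_three_term:
  assumes "subspace V" "as @ x # y # bs \<in> st_gens scale V" "x + y \<noteq> 0"
  shows "gen (as @ y # (x + y) # bs) - gen (as @ x # (x + y) # bs) + gen (as @ x # y # bs)
    \<in> qspan (st_relations scale V)"
proof -
  let ?R = "qspan (st_relations scale V)"
  define ws where "ws = as @ x # y # (x + y) # bs"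
  define n where "n = length as"
  let ?f = "\<lambda>i. qscale ((-1) ^ i) (gen (remove_at i ws))"
  let ?N = "{n, Suc n, Suc (Suc n)}"
  have as: "set as \<subseteq> V - {0}" "set bs \<subseteq> V - {0}" "x \<in> V - {0}" "y \<in> V - {0}"
    and len: "dim V = Suc (Suc (n + length bs))"
    using assms(2) by (auto simp: st_gens_def n_def)
  then have ws: "length ws = Suc (dim V)" "set ws \<subseteq> V - {0}"
    using subspace_add[OF assms(1)] assms(3) by (auto simp: ws_def n_def)
  have "?f i \<in> ?R" if i: "i \<in> {..dim V} - ?N" for i
  proof -
    have "{x, y, x + y} \<subseteq> set (remove_at i ws)"
    proof (cases "i < n")
      case True
      then show ?thesis by (simp add: ws_def n_def)
    next
      case False
      with i have "\<exists>j. i = n + Suc (Suc (Suc j))"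
        by (intro exI[of _ "i - n - 3"]) auto
      then obtain j where j: "i = n + Suc (Suc (Suc j))" by blast
      have "remove_at i ws = as @ x # y # (x + y) # remove_at j bs"
        unfolding j ws_def n_def remove_at_append(2) by simp
      then show ?thesis by simp
    qed
    then have "dependent (set (remove_at i ws))" using dependent_sum_triple as by blast
    moreover have "remove_at i ws \<in> st_gens scale V"
      using ws i set_remove_at[of i ws] by (auto simp: st_gens_def)
    ultimately show ?thesis by (intro qvs.span_scale st_rel_dependent) auto
  qed
  then have "(\<Sum>i\<in>{..dim V} - ?N. ?f i) \<in> ?R" by (rule qvs.span_sum)
  moreover have "(\<Sum>i\<le>dim V. ?f i) \<in> ?R" by (rule st_rel_sum[OF ws])
  moreover have "(\<Sum>i\<le>dim V. ?f i) = (\<Sum>i\<in>{..dim V} - ?N. ?f i) + (\<Sum>i\<in>?N. ?f i)"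
    by (rule sum.subset_diff) (auto simp: len)
  ultimately have "(\<Sum>i\<in>?N. ?f i) \<in> ?R" using qvs.span_diff by fastforce
  \<comment> \<open>The first surviving term has sign \<open>(-1) ^ n\<close>; this factor
    normalises the three signs to plus, minus, plus.\<close>
  then have "qscale ((-1) ^ n) (\<Sum>i\<in>?N. ?f i) \<in> ?R" by (rule qvs.span_scale)
  moreover have "remove_at n ws = as @ y # (x + y) # bs" "remove_at (Suc n) ws = as @ x # (x + y) # bs"
    "remove_at (Suc (Suc n)) ws = as @ x # y # bs"
    by (simp_all add: ws_def n_def)
  moreover have "(-1) ^ n * (-1) ^ n = (1 :: rat)"
    by (simp flip: power_mult_distrib)
  ultimately show ?thesis
    by (simp add: qvs.scale_right_distrib qvs.scale_right_diff_distrib single_uminus algebra_simps)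
qed

text \<open>Extension by zero removes the side conditions, provided the degenerate cases of the
  three-term relation are checked. This lemma serves each tensor factor separately.\<close>

lemma steinberg_symbol_additive:
  assumes "subspace V"
    and add: "\<And>x y. x \<in> free_on (st_gens scale V) \<Longrightarrow> y \<in> free_on (st_gens scale V) \<Longrightarrow> f (x + y) = f x + f y"
    and zero: "\<And>x. x \<in> qspan (st_relations scale V) \<Longrightarrow> f x = 0"
  shows "steinberg_symbol (\<lambda>vs. if vs \<in> st_gens scale V then f (gen vs) else 0)"
proof -
  let ?G = "st_gens scale V"
  have diff: "f (x - y) = f x - f y" if "x \<in> free_on ?G" "y \<in> free_on ?G" for x y
    using add[of "x - y" y] that qvs.subspace_diff[OF subspace_free_on that] by simp
  have neg_mem: "- x \<in> V \<longleftrightarrow> x \<in> V" for x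
    using subspace_neg[OF assms(1), of x] subspace_neg[OF assms(1), of "- x"] by auto
  have add_mem: "x \<in> V \<Longrightarrow> x + y \<in> V \<longleftrightarrow> y \<in> V" for x y
    using subspace_add[OF assms(1), of x y] subspace_diff[OF assms(1), of "x + y" x] by auto
  have swap: "f (gen (as @ y # x # bs)) = - f (gen (as @ x # y # bs))"
    if "as @ x # y # bs \<in> ?G" "as @ y # x # bs \<in> ?G" for as x y bs
    using zero[OF st_rel_swap[OF that(1)]] that by (simp add: add eq_neg_iff_add_eq_0)
  have dep: "f (gen vs) = 0" if "vs \<in> ?G" "\<not> distinct vs" for vs
    using zero[OF st_rel_dependent] that by auto
  show ?thesis
  proof
    fix as bs and x y :: 'b
    show "(if as @ x # y # bs \<in> ?G then f (gen (as @ x # y # bs)) else 0)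
      = - (if as @ y # x # bs \<in> ?G then f (gen (as @ y # x # bs)) else 0)"
      using swap[of as y x bs] by (auto simp: st_gens_def)
    show "(if as @ (- x) # bs \<in> ?G then f (gen (as @ (- x) # bs)) else 0)
      = (if as @ x # bs \<in> ?G then f (gen (as @ x # bs)) else 0)"
    proof (cases "as @ x # bs \<in> ?G")
      case True
      then have "as @ (- x) # bs \<in> ?G" by (simp add: st_gens_def neg_mem)
      with True zero[OF st_rel_neg[OF True]] show ?thesis by (simp add: diff)
    next
      case False
      then have "as @ (- x) # bs \<notin> ?G" by (simp add: st_gens_def neg_mem)
      with False show ?thesis by simp
    qed
    let ?xy = "as @ x # y # bs" and ?xs = "as @ x # (x + y) # bs" and ?ys = "as @ y # (x + y) # bs"
    \<comment> \<open>If \<open>x + y = 0\<close>, the right side vanishes and negating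
      \<open>y\<close> turns the left side into an apartment with a repeated entry. If
      \<open>x\<close> or \<open>y\<close> is zero, the only list that can still be a generator has
      a repeated entry. In the last case none of the three lists is a generator.\<close>
    consider "?xy \<in> ?G" "x + y \<noteq> 0" | "x + y = 0" | "x = 0" | "y = 0"
      | "?xy \<notin> ?G" "x \<noteq> 0" "y \<noteq> 0" "x + y \<noteq> 0" by blast
    then show "(if ?xy \<in> ?G then f (gen ?xy) else 0)
      = (if ?xs \<in> ?G then f (gen ?xs) else 0) - (if ?ys \<in> ?G then f (gen ?ys) else 0)"
    proof cases
      case 1
      then have "?xs \<in> ?G" "?ys \<in> ?G" by (auto simp: st_gens_def add_mem)
      moreover from this have "f (gen ?ys) - f (gen ?xs) + f (gen ?xy) = 0"
        using 1 zero[OF st_rel_three_term[OF assms(1) 1]]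
        by (simp add: diff add qvs.subspace_diff[OF subspace_free_on])
      ultimately show ?thesis using 1 by (simp add: algebra_simps)
    next
      case 2
      have "f (gen ?xy) = 0" if xy: "?xy \<in> ?G"
      proof -
        have y: "y = - x" using 2 by (simp add: eq_neg_iff_add_eq_0 add.commute)
        then have "gen ((as @ [x]) @ (- x) # bs) - gen ((as @ [x]) @ x # bs)
            \<in> qspan (st_relations scale V)"
          using xy by (intro st_rel_neg) (auto simp: st_gens_def neg_mem)
        moreover have "as @ x # x # bs \<in> ?G" using xy by (auto simp: st_gens_def)
        ultimately show ?thesis
          using zero[of "gen ?xy - gen (as @ x # x # bs)"] xy dep[of "as @ x # x # bs"] y
          by (simp add: diff)
      qed
      with 2 show ?thesis by (simp add: st_gens_def)
    next
      case 3
      then show ?thesis using dep[of ?ys] by (auto simp: st_gens_def)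
    next
      case 4
      then show ?thesis using dep[of ?xs] by (auto simp: st_gens_def)
    next
      case 5
      then have "?xs \<notin> ?G" "?ys \<notin> ?G"
        using add_mem[of y x] by (auto simp: st_gens_def add_mem add.commute)
      with 5 show ?thesis by simp
    qed
  qed
qed

end

section \<open>Bases and the product of the Steinberg module\<close>

lemma suffix_sums_map_upt:
  "suffix_sums (map v [k..<Suc d]) = map (\<lambda>i. \<Sum>j=i..d. v j) (rev [k..<Suc d])"
proof (induction "Suc d - k" arbitrary: k)
  case (Suc n)
  then have k: "[k..<Suc d] = k # [Suc k..<Suc d]" by (intro upt_conv_Cons) simp
  have "sum_list (map v [k..<Suc d]) = (\<Sum>j=k..d. v j)"
    by (simp only: interv_sum_list_conv_sum_set_nat set_upt atLeastLessThanSuc_atLeastAtMost)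
  then show ?case using Suc.hyps(1)[of "Suc k"] Suc.hyps(2) by (simp add: k)
qed simp

lemma differences_map_rev_upt:
  "differences u (map v (rev [1..<Suc d]))
    = map (\<lambda>i. if i = d then v d - u else v i - v (Suc i)) (rev [1..<Suc d])"
proof (induction d arbitrary: u)
  case (Suc d)
  have "rev [1..<Suc (Suc d)] = Suc d # rev [1..<Suc d]" by (simp add: upt_Suc)
  then show ?case by (simp only: list.map differences.simps Suc.IH) auto
qed simp

lemma map_shift_upt: "map (\<lambda>i. f (m + i)) [1..<Suc n] = map f [Suc m..<Suc (m + n)]"
  by (rule nth_equalityI) auto

context vector_space
begin

section \<open>Bases, and the generators obtained from them\<close>

lemma is_basis_dim: "is_basis scale V d v \<Longrightarrow> dim V = d"
  using dim_span_eq_card_independent[of "v ` {1..d}"] by (auto simp: is_basis_def card_image)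

lemma is_basis_finite_span:
  "is_basis scale V d v \<Longrightarrow> finite (v ` {1..d})"
  "is_basis scale V d v \<Longrightarrow> span (v ` {1..d}) = V"
  by (auto simp: is_basis_def)

lemma is_basis_nth:
  assumes "is_basis scale V d v" "i \<in> {1..d}"
  shows "v i \<in> V - {0}"
proof -
  have "v i \<in> v ` {1..d}" using assms(2) by (rule imageI)
  then show ?thesis
    using assms(1) span_base[of "v i" "v ` {1..d}"] dependent_zero[of "v ` {1..d}"]
    unfolding is_basis_def by auto
qed

lemma is_basis_sum_nonzero:
  assumes "is_basis scale V d v" "I \<subseteq> {1..d}" "I \<noteq> {}"
  shows "sum v I \<noteq> 0"
proof
  assume "sum v I = 0"
  moreover have "inj_on v I" "finite I"
    using assms inj_on_subset finite_subset[OF assms(2)] by (auto simp: is_basis_def)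
  ultimately have "(\<Sum>x\<in>v ` I. scale 1 x) = 0" by (simp add: sum.reindex)
  moreover obtain i where "i \<in> I" using assms(3) by blast
  moreover have "independent (v ` {1..d})" using assms(1) by (simp add: is_basis_def)
  ultimately have "(1 :: 'a) = 0"
    using independentD[of "v ` {1..d}" "v ` I" "\<lambda>_. 1" "v i"] image_mono[OF assms(2), of v] \<open>finite I\<close>
    by simp
  then show False by simp
qed

text \<open>Partial sums are nonzero by linear independence and differences by injectivity of the
  basis, so all words occurring in \<open>L\<close> and \<open>I\<close> are admissible
  generators.\<close>

lemma is_basis_st_gens:
  assumes "is_basis scale V d v"
  shows "map v (rev [1..<Suc d]) \<in> st_gens scale V"
    "suffix_sums (map v [1..<Suc d]) \<in> st_gens scale V"
    "differences 0 (map v (rev [1..<Suc d])) \<in> st_gens scale V"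
proof -
  have V: "subspace V" using assms by (auto simp: is_basis_def)
  have "(\<Sum>j=i..d. v j) \<in> V - {0}" if "i \<in> {1..d}" for i
  proof -
    have "v j \<in> V" if "j \<in> {i..d}" for j
      using that \<open>i \<in> {1..d}\<close> is_basis_nth[OF assms, of j] by simp
    then have "(\<Sum>j=i..d. v j) \<in> V" by (rule subspace_sum[OF V])
    moreover have "(\<Sum>j=i..d. v j) \<noteq> 0"
      by (rule is_basis_sum_nonzero[OF assms]) (use that in auto)
    ultimately show ?thesis by simp
  qed
  then show "suffix_sums (map v [1..<Suc d]) \<in> st_gens scale V"
    unfolding suffix_sums_map_upt by (auto simp: st_gens_def is_basis_dim[OF assms])
  have "inj_on v {1..d}" using assms by (simp add: is_basis_def)
  then have "v i \<noteq> v (Suc i)" if "i \<in> {1..d}" "i \<noteq> d" for i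
    using that inj_onD[of v "{1..d}" i "Suc i"] by auto
  then have "(if i = d then v d - 0 else v i - v (Suc i)) \<in> V - {0}" if "i \<in> {1..d}" for i
    using that subspace_diff[OF V, of "v i" "v (Suc i)"] is_basis_nth[OF assms, of i]
      is_basis_nth[OF assms, of "Suc i"] by auto
  then have "(\<lambda>i. if i = d then v d - 0 else v i - v (Suc i)) ` {1..d} \<subseteq> V - {0}"
    by (rule image_subsetI)
  then show "differences 0 (map v (rev [1..<Suc d])) \<in> st_gens scale V"
    unfolding differences_map_rev_upt
    by (simp only: st_gens_def mem_Collect_eq length_map length_rev length_upt diff_Suc_1 set_map
        set_rev set_upt atLeastLessThanSuc_atLeastAtMost is_basis_dim[OF assms] simp_thms)
  show "map v (rev [1..<Suc d]) \<in> st_gens scale V"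
    using is_basis_nth[OF assms] by (auto simp: st_gens_def is_basis_dim[OF assms])
qed

lemma is_basis_permute:
  assumes "is_basis scale V d v" "\<sigma> permutes {1..d}"
  shows "is_basis scale V d (v \<circ> \<sigma>)"
proof -
  have "(v \<circ> \<sigma>) ` {1..d} = v ` {1..d}"
    by (simp only: image_comp[symmetric] permutes_image[OF assms(2)])
  moreover have "inj_on (v \<circ> \<sigma>) {1..d}"
    using assms permutes_inj_on[OF assms(2)]
    by (intro comp_inj_on) (simp_all only: is_basis_def permutes_image)
  ultimately show ?thesis using assms(1) by (simp only: is_basis_def simp_thms)
qed

lemma is_basis_direct_sum:
  assumes V: "V = {x + y | x y. x \<in> V1 \<and> y \<in> V2}" "V1 \<inter> V2 = {0}"
    and b1: "is_basis scale V1 d1 v" and b2: "is_basis scale V2 d2 (\<lambda>i. v (d1 + i))"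
  shows "is_basis scale V (d1 + d2) v"
proof -
  let ?B1 = "v ` {1..d1}" and ?B2 = "v ` {Suc d1..d1 + d2}"
  have "(\<lambda>i. d1 + i) ` {1..d2} = {Suc d1..d1 + d2}" by simp
  then have B2: "(\<lambda>i. v (d1 + i)) ` {1..d2} = ?B2" by (metis image_image)
  have "{1..d1 + d2} = {1..d1} \<union> {Suc d1..d1 + d2}" by auto
  then have un: "v ` {1..d1 + d2} = ?B1 \<union> ?B2" by (simp only: image_Un)
  have sp: "span ?B1 = V1" "span ?B2 = V2" and ind: "independent ?B1" "independent ?B2"
    using b1 b2 unfolding is_basis_def B2 by auto
  have sub: "?B1 \<subseteq> V1" "?B2 \<subseteq> V2" using span_superset[of ?B1] span_superset[of ?B2] sp by simp_all
  \<comment> \<open>A common basis vector would lie in \<open>V1 \<inter> V2\<close> and hence be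
    zero, which is not in an independent set.\<close>
  have "0 \<notin> ?B1" using ind(1) dependent_zero[of ?B1] by blast
  moreover have "?B1 \<inter> ?B2 \<subseteq> {0}" unfolding V(2)[symmetric] by (rule Int_mono[OF sub])
  ultimately have disj: "?B1 \<inter> ?B2 = {}" by (simp only: subset_singleton_iff) blast
  have inj: "inj_on v {1..d1 + d2}"
  proof (rule inj_onI)
    have inj1: "inj_on v {1..d1}" and inj2: "inj_on (\<lambda>i. v (d1 + i)) {1..d2}"
      using b1 b2 by (simp_all add: is_basis_def)
    have ne: "v i \<noteq> v j" if "i \<in> {1..d1}" "j \<in> {Suc d1..d1 + d2}" for i j
      using disj imageI[OF that(1), of v] imageI[OF that(2), of v] by (metis IntI empty_iff)
    fix i j assume *: "i \<in> {1..d1 + d2}" "j \<in> {1..d1 + d2}" "v i = v j"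
    consider "i \<le> d1" "j \<le> d1" | "i \<le> d1" "d1 < j" | "d1 < i" "j \<le> d1" | "d1 < i" "d1 < j"
      by linarith
    then show "i = j"
    proof cases
      case 1
      with * inj_onD[OF inj1] show ?thesis by simp
    next
      case 4
      have "i - d1 = j - d1" by (rule inj_onD[OF inj2]) (use * 4 in auto)
      with 4 show ?thesis by simp
    qed (use * ne[of i j] ne[of j i] in auto)
  qed
  have "independent (?B1 \<union> ?B2)"
  proof (rule independent_if_scalars_zero)
    fix f x assume 0: "(\<Sum>x\<in>?B1 \<union> ?B2. scale (f x) x) = 0" and x: "x \<in> ?B1 \<union> ?B2"
    let ?s = "\<lambda>B. \<Sum>x\<in>B. scale (f x) x"
    have "?s ?B1 + ?s ?B2 = 0" using 0 disj by (simp add: sum.union_disjoint)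
    then have "?s ?B1 = - ?s ?B2" by (rule eq_neg_iff_add_eq_0[THEN iffD2])
    moreover have "?s ?B1 \<in> span ?B1" "- ?s ?B2 \<in> span ?B2"
      by (intro span_sum span_neg span_scale span_base; assumption)+
    ultimately have "?s ?B1 \<in> V1 \<inter> V2" unfolding sp by simp
    with V(2) have "?s ?B1 = 0" by simp
    moreover from this \<open>?s ?B1 + ?s ?B2 = 0\<close> have "?s ?B2 = 0" by simp
    ultimately show "f x = 0"
      using x independentD[OF ind(1) _ subset_refl] independentD[OF ind(2) _ subset_refl]
      by (elim UnE) simp_all
  qed simp
  moreover have "span (?B1 \<union> ?B2) = V" unfolding span_Un sp V(1) ..
  ultimately show ?thesis using inj by (simp only: is_basis_def un simp_thms)
qed

section \<open>Pure tensors of apartments\<close>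

lemma apartment_closed: "vs \<in> st_gens scale V \<Longrightarrow> apartment scale V vs \<in> carrier (St scale V)"
  by (simp add: St_simps)

text \<open>With one tensor factor fixed, the bilinearity relations make \<tau> additive in the
  other. Each argument is therefore a symbol by \<open>steinberg_symbol_additive\<close>.\<close>

lemma steinberg_pairing_tensor:
  fixes \<tau> :: "('b st_elt \<times> 'b st_elt \<Rightarrow>\<^sub>0 rat) \<Rightarrow> ('b st_elt \<times> 'b st_elt \<Rightarrow>\<^sub>0 rat)"
  assumes "subspace V"
    and add: "\<And>x y. \<tau> (x + y) = \<tau> x + \<tau> y"
    and zero: "\<And>x. x \<in> tensor_relations (St scale V) (St scale V) \<Longrightarrow> \<tau> x = 0"
  shows "steinberg_pairing (\<lambda>a b. if a \<in> st_gens scale V \<and> b \<in> st_gens scale V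
    then \<tau> (gen (apartment scale V a, apartment scale V b)) else 0)"
proof -
  let ?G = "st_gens scale V" and ?S = "St scale V" and ?Q = "coset (qspan (st_relations scale V))"
  have diff: "\<tau> (x - y) = \<tau> x - \<tau> y" for x y using add[of "x - y" y] by simp
  have carr: "?Q x \<in> carrier ?S" if "x \<in> free_on ?G" for x
    using that by (simp add: St_simps)
  have q_add: "?Q (x + y) = ?Q x \<oplus>\<^bsub>?S\<^esub> ?Q y" for x y
    by (simp add: St_def presented_add)
  have sym: "steinberg_symbol (\<lambda>vs. if vs \<in> ?G then h (?Q (gen vs)) else 0)"
    if h: "\<And>x y. x \<in> carrier ?S \<Longrightarrow> y \<in> carrier ?S \<Longrightarrow> h (x \<oplus>\<^bsub>?S\<^esub> y) = h x + h y"
    for h :: "'b st_elt \<Rightarrow> ('b st_elt \<times> 'b st_elt \<Rightarrow>\<^sub>0 rat)"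
  proof (rule steinberg_symbol_additive[OF assms(1)])
    fix x assume "x \<in> qspan (st_relations scale V)"
    then have "?Q x = ?Q 0" by (simp add: coset_eq_iff)
    moreover have "0 \<in> free_on ?G" by (rule qvs.subspace_0[OF subspace_free_on])
    ultimately show "h (?Q x) = 0" using h[of "?Q 0" "?Q 0"] by (simp add: carr flip: q_add)
  qed (simp add: h carr q_add)
  have "steinberg_symbol (\<lambda>a. if a \<in> ?G then \<tau> (gen (apartment scale V a, Y)) else 0)"
    "steinberg_symbol (\<lambda>a. if a \<in> ?G then \<tau> (gen (Y, apartment scale V a)) else 0)"
    if Y: "Y \<in> carrier ?S" for Y
    unfolding St_simps(3)
  proof -
    show "steinberg_symbol (\<lambda>a. if a \<in> ?G then \<tau> (gen (?Q (gen a), Y)) else 0)"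
      using zero[OF tensor_relationsI(1)] Y
      by (intro sym[of "\<lambda>x. \<tau> (gen (x, Y))"]) (simp add: diff add algebra_simps)
    show "steinberg_symbol (\<lambda>a. if a \<in> ?G then \<tau> (gen (Y, ?Q (gen a))) else 0)"
      using zero[OF tensor_relationsI(2)] Y
      by (intro sym[of "\<lambda>x. \<tau> (gen (Y, x))"]) (simp add: diff add algebra_simps)
  qed
  \<comment> \<open>This covers the case in which the fixed argument is not a generator, where the
    extension by zero is constant.\<close>
  moreover have "steinberg_symbol (\<lambda>_ :: 'b list. 0 :: 'b st_elt \<times> 'b st_elt \<Rightarrow>\<^sub>0 rat)"
    by unfold_locales simp_all
  ultimately have "steinberg_symbol (\<lambda>a. if a \<in> ?G \<and> b \<in> ?G then \<tau> (gen (apartment scale V a, apartment scale V b)) else 0)"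
    "steinberg_symbol (\<lambda>a. if b \<in> ?G \<and> a \<in> ?G then \<tau> (gen (apartment scale V b, apartment scale V a)) else 0)"
    for b
    by (cases "b \<in> ?G"; simp add: apartment_closed)+
  then show ?thesis by (intro steinberg_pairing.intro)
qed

lemma smult_pure_tensor:
  assumes "x \<in> carrier (St scale V)" "y \<in> carrier (St scale V)"
  shows "coset (qspan (tensor_relations (St scale V) (St scale V))) (qscale c (gen (x, y)))
    = st_tensor scale V (c \<odot>\<^bsub>St scale V\<^esub> x) y"
  using pure_tensor_smult_left[OF assms] by (simp only: pure_tensor_coset tensor_def presented_smult)

lemma smult_smult_St:
  assumes "x \<in> carrier (St scale V)"
  shows "a \<odot>\<^bsub>St scale V\<^esub> (b \<odot>\<^bsub>St scale V\<^esub> x) = (a * b) \<odot>\<^bsub>St scale V\<^esub> x"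
  using assms by (auto simp: St_def presented_simps presented_smult)

lemma smult_closed_St: "x \<in> carrier (St scale V) \<Longrightarrow> c \<odot>\<^bsub>St scale V\<^esub> x \<in> carrier (St scale V)"
  unfolding St_def by (rule presented_smult_closed)

text \<open>The scalars are moved into the left tensor factors, where bilinearity of
  \<open>st_mult\<close> multiplies them. They are 1 for \<open>L\<close> and the powers of -1 for
  \<open>I\<close>.\<close>

lemma st2_mult_apartments:
  assumes subs: "V1 \<subseteq> V" "V2 \<subseteq> V"
    and fd: "finite B1" "span B1 = V1" "finite B2" "span B2 = V2"
    and dims: "dim V = dim V1 + dim V2"
    and gens: "a1 \<in> st_gens scale V1" "b1 \<in> st_gens scale V1"
      "a2 \<in> st_gens scale V2" "b2 \<in> st_gens scale V2"
  shows "st2_mult scale V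
      (coset (qspan (tensor_relations (St scale V1) (St scale V1)))
        (qscale c1 (gen (apartment scale V1 a1, apartment scale V1 b1))))
      (coset (qspan (tensor_relations (St scale V2) (St scale V2)))
        (qscale c2 (gen (apartment scale V2 a2, apartment scale V2 b2))))
    = coset (qspan (tensor_relations (St scale V) (St scale V)))
        (qscale (c1 * c2) (gen (apartment scale V (a1 @ a2), apartment scale V (b1 @ b2))))"
  using gens st_gens_append[OF subs fd dims gens(1,3)] st_gens_append[OF subs fd dims gens(2,4)]
  by (simp add: smult_pure_tensor apartment_closed smult_closed_St smult_smult_St mult.commute
      st2_mult_pure_tensor[OF subs fd dims] st_mult_bilinear[OF subs fd dims]
      st_mult_apartment[OF subs fd dims] del: qscale_single)

section \<open>The two shuffle product formulas\<close>

lemma steinberg_L_eq: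
  "steinberg_L scale V d v = coset (qspan (tensor_relations (St scale V) (St scale V)))
    (gen (apartment scale V (suffix_sums (map v [1..<Suc d])),
      apartment scale V (map v (rev [1..<Suc d]))))"
  by (simp only: steinberg_L_def pure_tensor_coset suffix_sums_map_upt)

lemma steinberg_I_eq:
  "steinberg_I scale V d v = coset (qspan (tensor_relations (St scale V) (St scale V)))
    (qscale ((-1) ^ d) (gen (apartment scale V (map v (rev [1..<Suc d])),
      apartment scale V (differences 0 (map v (rev [1..<Suc d]))))))"
  by (simp only: steinberg_I_def St2_def tensor_def presented_smult pure_tensor_coset
      differences_map_rev_upt diff_0_right)

lemma finsum_St2:
  assumes "finite I" "\<And>i. i \<in> I \<Longrightarrow> f i \<in> st_gens scale V" "\<And>i. i \<in> I \<Longrightarrow> g i \<in> st_gens scale V"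
  shows "(\<Oplus>\<^bsub>St2 scale V\<^esub> i\<in>I. coset (qspan (tensor_relations (St scale V) (St scale V)))
      (qscale c (gen (apartment scale V (f i), apartment scale V (g i)))))
    = coset (qspan (tensor_relations (St scale V) (St scale V)))
      (qscale c (\<Sum>i\<in>I. gen (apartment scale V (f i), apartment scale V (g i))))"
  unfolding St2_def tensor_def qvs.scale_sum_right
  by (rule finsum_presented[OF assms(1)])
    (use assms in \<open>auto simp: apartment_closed simp del: qscale_single
      intro!: qvs.subspace_scale[OF subspace_free_on]\<close>)


lemma steinberg_shuffle_products:
  assumes V: "V = {x + y | x y. x \<in> V1 \<and> y \<in> V2}" "V1 \<inter> V2 = {0}"
    and b1: "is_basis scale V1 d1 v" and b2: "is_basis scale V2 d2 (\<lambda>i. v (d1 + i))"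
  shows "st2_mult scale V (steinberg_L scale V1 d1 v) (steinberg_L scale V2 d2 (\<lambda>i. v (d1 + i)))
      = (\<Oplus>\<^bsub>St2 scale V\<^esub> \<sigma> \<in> shuffle_perms d1 d2. steinberg_L scale V (d1 + d2) (v \<circ> \<sigma>))"
      (is ?L)
    and "st2_mult scale V (steinberg_I scale V1 d1 v) (steinberg_I scale V2 d2 (\<lambda>i. v (d1 + i)))
      = (\<Oplus>\<^bsub>St2 scale V\<^esub> \<sigma> \<in> shuffle_perms d1 d2. steinberg_I scale V (d1 + d2) (v \<circ> \<sigma>))"
      (is ?I)
proof -
  let ?d = "d1 + d2" and ?A = "apartment scale V" and ?G = "st_gens scale V"
  let ?T = "tensor_relations (St scale V) (St scale V)"
  let ?xs = "[1..<Suc d1]" and ?ys = "[Suc d1..<Suc ?d]" and ?zs = "[1..<Suc ?d]"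
  have b: "is_basis scale V ?d v" by (rule is_basis_direct_sum[OF V b1 b2])
  have zero: "0 \<in> V1" "0 \<in> V2" using V(2) by auto
  have subs: "V1 \<subseteq> V" "V2 \<subseteq> V"
    using zero unfolding V(1) by (fastforce intro: exI[of _ 0])+
  have dims: "dim V = dim V1 + dim V2"
    by (simp only: is_basis_dim[OF b] is_basis_dim[OF b1] is_basis_dim[OF b2])
  note mult = st2_mult_apartments[OF subs is_basis_finite_span[OF b1] is_basis_finite_span[OF b2] dims]
  have shift: "map (\<lambda>i. v (d1 + i)) [1..<Suc d2] = map v ?ys"
    "map (\<lambda>i. v (d1 + i)) (rev [1..<Suc d2]) = map v (rev ?ys)"
    by (simp_all only: map_shift_upt rev_map[symmetric])
  note gens1 = is_basis_st_gens[OF b1] and gens2 = is_basis_st_gens[OF b2, unfolded shift]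
  note gens_append = st_gens_append[OF subs is_basis_finite_span[OF b1] is_basis_finite_span[OF b2] dims]
  have perm: "map (v \<circ> \<sigma>) (rev ?zs) \<in> ?G" "suffix_sums (map (v \<circ> \<sigma>) ?zs) \<in> ?G"
    "differences 0 (map (v \<circ> \<sigma>) (rev ?zs)) \<in> ?G" if "\<sigma> \<in> shuffle_perms d1 d2" for \<sigma>
  proof -
    have "\<sigma> permutes {1..?d}" using that by (simp add: shuffle_perms_def)
    from is_basis_st_gens[OF is_basis_permute[OF b this]]
    show "map (v \<circ> \<sigma>) (rev ?zs) \<in> ?G" "suffix_sums (map (v \<circ> \<sigma>) ?zs) \<in> ?G"
      "differences 0 (map (v \<circ> \<sigma>) (rev ?zs)) \<in> ?G" .
  qed
  \<comment> \<open>The kernel of \<tau> is exactly the span of the tensor relations, so comparing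
    values of \<tau> decides equality in \<open>St2 scale V\<close>.\<close>
  obtain \<tau> :: "('b st_elt \<times> 'b st_elt \<Rightarrow>\<^sub>0 rat) \<Rightarrow> ('b st_elt \<times> 'b st_elt \<Rightarrow>\<^sub>0 rat)"
    where \<tau>: "Vector_Spaces.linear qscale qscale \<tau>" "\<forall>x. \<tau> x = 0 \<longleftrightarrow> x \<in> qspan ?T"
    using qvs.exists_linear_with_kernel[OF qvs.subspace_span[of ?T]] by blast
  interpret \<tau>: Vector_Spaces.linear qscale qscale \<tau> by (rule \<tau>(1))
  have coset_eq: "coset (qspan ?T) x = coset (qspan ?T) y \<longleftrightarrow> \<tau> x = \<tau> y" for x y
    by (simp only: coset_eq_iff \<tau>(2)[rule_format, symmetric] \<tau>.diff eq_iff_diff_eq_0[symmetric])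
  define \<Phi> where "\<Phi> = (\<lambda>a b. if a \<in> ?G \<and> b \<in> ?G then \<tau> (gen (?A a, ?A b)) else 0)"
  have \<Phi>: "\<tau> (gen (?A a, ?A b)) = \<Phi> a b" if "a \<in> ?G" "b \<in> ?G" for a b
    using that by (simp only: \<Phi>_def simp_thms if_True)
  have "subspace V" using b subspace_span by (auto simp: is_basis_def)
  then interpret steinberg_pairing \<Phi>
    unfolding \<Phi>_def by (rule steinberg_pairing_tensor) (simp_all only: \<tau>.add \<tau>(2)[rule_format] qvs.span_base)
  show ?L
  proof -
    have "\<tau> (gen (?A (suffix_sums (map v ?xs) @ suffix_sums (map v ?ys)), ?A (map v (rev ?xs) @ map v (rev ?ys))))
      = \<Phi> (suffix_sums (map v ?xs) @ suffix_sums (map v ?ys)) (map v (rev ?xs) @ map v (rev ?ys))"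
      by (intro \<Phi> gens_append gens1 gens2)
    \<comment> \<open>The letters are the indices \<open>1..d\<close>, which are distinct, and both
      accumulators start empty.\<close>
    also have "\<dots> = (\<Sum>zs\<in>shuffles ?xs ?ys. \<Phi> (suffix_sums (map v zs)) (map v (rev zs)))"
      using shuffle_suffix_sums[of ?xs ?ys v "[]" "[]"]
      by (simp only: append_Nil2 rev_map) simp
    also have "\<dots> = (\<Sum>\<sigma>\<in>shuffle_perms d1 d2. \<Phi> (suffix_sums (map (v \<circ> \<sigma>) ?zs)) (map (v \<circ> \<sigma>) (rev ?zs)))"
      by (simp only: sum_shuffles_eq_sum_shuffle_perms rev_map map_map)
    also have "\<dots> = (\<Sum>\<sigma>\<in>shuffle_perms d1 d2.
        \<tau> (gen (?A (suffix_sums (map (v \<circ> \<sigma>) ?zs)), ?A (map (v \<circ> \<sigma>) (rev ?zs)))))"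
      by (intro sum.cong refl \<Phi>[symmetric] perm)
    finally show ?thesis
      using finsum_St2[OF finite_shuffle_perms perm(2) perm(1), where c = 1]
        mult[OF gens1(2,1) gens2(2,1), of 1 1]
      by (simp only: steinberg_L_eq shift qvs.scale_one mult_1 coset_eq \<tau>.sum)
  qed
  show ?I
  proof -
    have "\<tau> (gen (?A (map v (rev ?xs) @ map v (rev ?ys)),
        ?A (differences 0 (map v (rev ?xs)) @ differences 0 (map v (rev ?ys)))))
      = \<Phi> (map v (rev ?xs) @ map v (rev ?ys))
        (differences 0 (map v (rev ?xs)) @ differences 0 (map v (rev ?ys)))"
      by (intro \<Phi> gens_append gens1 gens2)
    also have "\<dots> = (\<Sum>zs\<in>shuffles (rev ?xs) (rev ?ys). \<Phi> (map v zs) (differences 0 (map v zs)))"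
      using shuffle_differences[of "rev ?xs" "rev ?ys" "[]" v "[]" 0]
      by (simp only: append_Nil) simp
    also have "\<dots> = (\<Sum>\<sigma>\<in>shuffle_perms d1 d2.
        \<Phi> (map (v \<circ> \<sigma>) (rev ?zs)) (differences 0 (map (v \<circ> \<sigma>) (rev ?zs))))"
      by (simp only: sum_rev_shuffles_eq_sum_shuffle_perms map_map)
    also have "\<dots> = (\<Sum>\<sigma>\<in>shuffle_perms d1 d2.
        \<tau> (gen (?A (map (v \<circ> \<sigma>) (rev ?zs)), ?A (differences 0 (map (v \<circ> \<sigma>) (rev ?zs))))))"
      by (intro sum.cong refl \<Phi>[symmetric] perm)
    finally show ?thesis
      \<comment> \<open>The signs of the two factors multiply to \<open>(-1) ^ (d1 + d2)\<close>,
        which is common to all summands and comes out by linearity of \<tau>.\<close>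
      using finsum_St2[OF finite_shuffle_perms perm(1) perm(3), where c = "(-1) ^ ?d"]
        mult[OF gens1(1,3) gens2(1,3), of "(-1) ^ d1" "(-1) ^ d2"]
      by (simp only: steinberg_I_eq shift power_add[symmetric] coset_eq \<tau>.scale \<tau>.sum)
  qed
qed

end

theorem proposition33:
  fixes s :: "'f::field \<Rightarrow> 'v::ab_group_add \<Rightarrow> 'v"
    and V V1 V2 :: "'v set"
    and v :: "nat \<Rightarrow> 'v"
    and d1 d2 d :: nat
  assumes "vector_space s"
    and "module.subspace s V"
    and "\<exists>B. finite B \<and> module.span s B = V"
    and "module.subspace s V1"
    and "module.subspace s V2"
    and "V = {x + y | x y. x \<in> V1 \<and> y \<in> V2}"
    and "V1 \<inter> V2 = {0}"
    and "is_basis s V1 d1 v"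
    and "is_basis s V2 d2 (\<lambda>i. v (d1 + i))"
    and "d = d1 + d2"
  shows "st2_mult s V (steinberg_L s V1 d1 v) (steinberg_L s V2 d2 (\<lambda>i. v (d1 + i)))
      = (\<Oplus>\<^bsub>St2 s V\<^esub> \<sigma> \<in> shuffle_perms d1 d2. steinberg_L s V d (v \<circ> \<sigma>))
    \<and> st2_mult s V (steinberg_I s V1 d1 v) (steinberg_I s V2 d2 (\<lambda>i. v (d1 + i)))
      = (\<Oplus>\<^bsub>St2 s V\<^esub> \<sigma> \<in> shuffle_perms d1 d2. steinberg_I s V d (v \<circ> \<sigma>))"
  using vector_space.steinberg_shuffle_products[OF assms(1,6-9)] unfolding assms(10) by blast

end
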